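(* Let $\alpha:\mathbb{R}^2\to\mathbb{R}$ be a harmonic function and let $\lambda$ be a harmonic conjugate function such that $\Psi=\begin{pmatrix}\lambda\\-\alpha\end{pmatrix}$ is holomorphic (i.e. $\Psi=\lambda-i\alpha$ is entire, identifying $\mathbb{R}^2$ with $\mathbb{C}$). Let $\Phi$ be any complex primitive of $\exp(\Psi)$, as a holomorphic function on $\mathbb{C}$. Let $H\in(0,1)$, $\delta>0$, let $X=X_{0,\delta}$ be the standard elementary field, and let $Z_{\Phi,X}(x)=X(\Phi(x))$. Then at any point $x_0\in\mathbb{R}^2$, an approximate (up to $\delta^2$) local orientation of $Z_{\Phi,X}$ is $$\vec n_Z(x_0)=\begin{pmatrix}\cos(\alpha(x_0))\\ \sin(\alpha(x_0))\end{pmatrix}.$$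
   Context: Gaussian fields are real-valued, centered, indexed by $\mathbb{R}^2$. $\mathrm{j}$ is the imaginary unit; $\arg$ is taken modulo $2\pi$; $\mathbb{S}^1$ is the unit circle of $\mathbb{R}^2$ with arc length $d\Theta$. For an $H$-self-similar Gaussian field $Y$ with stationary increments and spectral density $f_Y$, i.e. $\mathbb{E}[Y(x)Y(y)]=\int(e^{\mathrm{j}\langle x,\xi\rangle}-1)(e^{-\mathrm{j}\langle y,\xi\rangle}-1)f_Y(\xi)\,d\xi$, one has $f_Y(\xi)=\|\xi\|^{-2H-2}C_Y(\xi/\|\xi\|)$; $C_Y$ is the anisotropy function. The structure tensor of $Y$ is the $2\times2$ matrix $\mathbf{J}_Y$ with entries $\int_{\mathbb{S}^1}\Theta_{\ell_1}\Theta_{\ell_2}C_Y(\Theta)\,d\Theta$; an orientation of $Y$ is any unit eigenvector of $\mathbf{J}_Y$ for its largest eigenvalue. The standard elementary field $X_{0,\delta}$ is the $H$-self-similar Gaussian field with stationary increments with anisotropy function $$C_X(\Theta)=\frac1{4\delta}\Big(\mathbf{1}_{[-\delta,\delta]}(\arg\Theta)+\mathbf{1}_{[\pi-\delta,\pi+\delta]}(\arg\Theta)\Big).$$ A random field $Z$ is $H$-localizable at $x_0$ with tangent field the non-trivial random field $Y_{x_0}$ if $\{\rho^{-H}(Z(x_0+\rho u)-Z(x_0))\}_{u\in\mathbb{R}^2}$ converges in distribution (weak convergence of stochastic processes, continuous versions) to $\{Y_{x_0}(u)\}_u$ as $\rho\to0$. The local structure tensor $\mathbf{J}_{x_0}$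 and a local orientation of $Z$ at $x_0$ are the structure tensor and an orientation of its tangent field $Y_{x_0}$. For fields depending on $\delta>0$, a unit vector $\vec m$ (independent of $\delta$) is an approximate (up to $\delta^2$) local orientation at $x_0$ if there is a constant $c>0$ independent of $\delta$ such that $\mathbf{J}_{x_0}=c\,\vec m\,\vec m^{T}+O(\delta^2)$ as $\delta\to0$. *)

theory Defs
  imports "HOL-Probability.Probability" "HOL-Complex_Analysis.Complex_Analysis"
begin

definition complex_of_vec :: "real^2 \<Rightarrow> complex" where
  "complex_of_vec x = Complex (x $ 1) (x $ 2)"

definition vec_of_complex :: "complex \<Rightarrow> real^2" where
  "vec_of_complex z = vector [Re z, Im z]"


definition partial_deriv :: "2 \<Rightarrow> (real^2 \<Rightarrow> real) \<Rightarrow> real^2 \<Rightarrow> real" where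
  "partial_deriv i u x = deriv (\<lambda>t. u (x + t *\<^sub>R axis i 1)) 0"

definition harmonic :: "(real^2 \<Rightarrow> real) \<Rightarrow> bool" where
  "harmonic u \<longleftrightarrow>
     (\<forall>x. u differentiable (at x)) \<and>
     (\<forall>i x. partial_deriv i u differentiable (at x)) \<and>
     (\<forall>i j. continuous_on UNIV (partial_deriv j (partial_deriv i u))) \<and>
     (\<forall>x. (\<Sum>i\<in>UNIV. partial_deriv i (partial_deriv i u) x) = 0)"


text \<open>
  A random field on a probability space \<open>M\<close> is a function \<open>Y\<close> with \<open>Y x\<close> a real random variable
  for each point \<open>x\<close> of the plane.  Degenerate (almost surely zero) linear combinations count as
  Gaussian; for instance \<open>Y 0\<close> is degenerate for a self-similar field.
\<close>

definition centered_gaussian_rv :: "'w measure \<Rightarrow> ('w \<Rightarrow> real) \<Rightarrow> bool" where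
  "centered_gaussian_rv M V \<longleftrightarrow>
     V \<in> borel_measurable M \<and>
     ((AE \<omega> in M. V \<omega> = 0) \<or> (\<exists>\<sigma>>0. distributed M lborel V (normal_density 0 \<sigma>)))"

definition gaussian_field :: "'w measure \<Rightarrow> (real^2 \<Rightarrow> 'w \<Rightarrow> real) \<Rightarrow> bool" where
  "gaussian_field M Y \<longleftrightarrow>
     (\<forall>S a. finite S \<longrightarrow> centered_gaussian_rv M (\<lambda>\<omega>. \<Sum>x\<in>S. a x * Y x \<omega>))"

definition same_fdd ::
  "'w measure \<Rightarrow> (real^2 \<Rightarrow> 'w \<Rightarrow> real) \<Rightarrow> (real^2 \<Rightarrow> 'w \<Rightarrow> real) \<Rightarrow> bool" where
  "same_fdd M Y Y' \<longleftrightarrow>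
     (\<forall>S. finite S \<longrightarrow>
        distr M (Pi\<^sub>M S (\<lambda>_. borel)) (\<lambda>\<omega>. \<lambda>x\<in>S. Y x \<omega>) =
        distr M (Pi\<^sub>M S (\<lambda>_. borel)) (\<lambda>\<omega>. \<lambda>x\<in>S. Y' x \<omega>))"

definition self_similar :: "real \<Rightarrow> 'w measure \<Rightarrow> (real^2 \<Rightarrow> 'w \<Rightarrow> real) \<Rightarrow> bool" where
  "self_similar H M Y \<longleftrightarrow>
     (\<forall>\<rho>>0. same_fdd M (\<lambda>x. Y (\<rho> *\<^sub>R x)) (\<lambda>x \<omega>. \<rho> powr H * Y x \<omega>))"

definition stationary_increments :: "'w measure \<Rightarrow> (real^2 \<Rightarrow> 'w \<Rightarrow> real) \<Rightarrow> bool" where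
  "stationary_increments M Y \<longleftrightarrow>
     (\<forall>h. same_fdd M (\<lambda>x \<omega>. Y (x + h) \<omega> - Y h \<omega>) (\<lambda>x \<omega>. Y x \<omega> - Y 0 \<omega>))"

definition spectral_kernel :: "real^2 \<Rightarrow> real^2 \<Rightarrow> real^2 \<Rightarrow> complex" where
  "spectral_kernel x y \<xi> =
     (exp (\<i> * of_real (x \<bullet> \<xi>)) - 1) * (exp (- \<i> * of_real (y \<bullet> \<xi>)) - 1)"

definition has_spectral_density ::
  "'w measure \<Rightarrow> (real^2 \<Rightarrow> 'w \<Rightarrow> real) \<Rightarrow> (real^2 \<Rightarrow> real) \<Rightarrow> bool" where
  "has_spectral_density M Y f \<longleftrightarrow>
     f \<in> borel_measurable borel \<and> (\<forall>\<xi>. 0 \<le> f \<xi>) \<and>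
     (\<forall>x y. integrable lborel (\<lambda>\<xi>. spectral_kernel x y \<xi> * of_real (f \<xi>)) \<and>
            of_real (\<integral>\<omega>. Y x \<omega> * Y y \<omega> \<partial>M) =
              (\<integral>\<xi>. spectral_kernel x y \<xi> * of_real (f \<xi>) \<partial>lborel))"

text \<open>
  \<open>Y\<close> is an \<open>H\<close>-self-similar Gaussian field with stationary increments whose anisotropy function
  is \<open>C\<close>.  Only the values of \<open>C\<close> on the unit circle matter: at \<open>\<xi> = 0\<close> the factor
  \<open>norm \<xi> powr (-2 * H - 2)\<close> is \<open>0\<close>.
\<close>

definition self_similar_gaussian_field ::
  "real \<Rightarrow> 'w measure \<Rightarrow> (real^2 \<Rightarrow> 'w \<Rightarrow> real) \<Rightarrow> (real^2 \<Rightarrow> real) \<Rightarrow> bool" where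
  "self_similar_gaussian_field H M Y C \<longleftrightarrow>
     prob_space M \<and> gaussian_field M Y \<and> self_similar H M Y \<and> stationary_increments M Y \<and>
     has_spectral_density M Y (\<lambda>\<xi>. norm \<xi> powr (-2 * H - 2) * C (\<xi> /\<^sub>R norm \<xi>))"

text \<open>Integration over the unit circle with respect to arc length, by angular parametrization.\<close>

definition circle_point :: "real \<Rightarrow> real^2" where
  "circle_point \<theta> = vector [cos \<theta>, sin \<theta>]"

definition structure_tensor :: "(real^2 \<Rightarrow> real) \<Rightarrow> real^2^2" where
  "structure_tensor C =
     (\<chi> k l. LINT \<theta>:{0..2 * pi}|lborel.
               circle_point \<theta> $ k * circle_point \<theta> $ l * C (circle_point \<theta>))"


text \<open>The argument is understood modulo \<open>2 * pi\<close>, whereas \<open>Arg\<close> is its principal value.\<close>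

definition arg_in :: "real set \<Rightarrow> real^2 \<Rightarrow> bool" where
  "arg_in I \<Theta> \<longleftrightarrow> (\<exists>k::int. Arg (complex_of_vec \<Theta>) + 2 * pi * of_int k \<in> I)"

definition elementary_anisotropy :: "real \<Rightarrow> real^2 \<Rightarrow> real" where
  "elementary_anisotropy \<delta> \<Theta> =
     1 / (4 * \<delta>) * (of_bool (arg_in {-\<delta>..\<delta>} \<Theta>) + of_bool (arg_in {pi - \<delta>..pi + \<delta>} \<Theta>))"

definition standard_elementary_field ::
  "real \<Rightarrow> real \<Rightarrow> 'w measure \<Rightarrow> (real^2 \<Rightarrow> 'w \<Rightarrow> real) \<Rightarrow> bool" where
  "standard_elementary_field H \<delta> M X \<longleftrightarrow>
     self_similar_gaussian_field H M X (elementary_anisotropy \<delta>)"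


definition continuous_version ::
  "'w measure \<Rightarrow> (real^2 \<Rightarrow> 'w \<Rightarrow> real) \<Rightarrow> (real^2 \<Rightarrow> 'w \<Rightarrow> real) \<Rightarrow> bool" where
  "continuous_version M Z Z' \<longleftrightarrow>
     (\<forall>x. Z' x \<in> borel_measurable M) \<and>
     (\<forall>x. AE \<omega> in M. Z' x \<omega> = Z x \<omega>) \<and>
     (\<forall>\<omega>\<in>space M. continuous_on UNIV (\<lambda>x. Z' x \<omega>))"

text \<open>
  Bounded continuous functionals on the space of continuous functions on the plane, with the
  topology of uniform convergence on compact sets.  This topology is metrizable, so sequential
  continuity suffices.
\<close>

definition bounded_continuous_functional :: "((real^2 \<Rightarrow> real) \<Rightarrow> real) \<Rightarrow> bool" where
  "bounded_continuous_functional F \<longleftrightarrow>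
     (\<exists>B. \<forall>g. continuous_on UNIV g \<longrightarrow> \<bar>F g\<bar> \<le> B) \<and>
     (\<forall>g h. (\<forall>n. continuous_on UNIV (g n)) \<longrightarrow> continuous_on UNIV h \<longrightarrow>
        (\<forall>K. compact K \<longrightarrow> uniform_limit K g h sequentially) \<longrightarrow>
        (\<lambda>n. F (g n)) \<longlonglongrightarrow> F h)"

text \<open>
  Weak convergence of fields with continuous paths, as random elements of that function space.
  Its Borel sets are generated by the coordinate evaluations, so the integrands are measurable.
\<close>

definition converges_in_distribution ::
  "'w measure \<Rightarrow> (real \<Rightarrow> real^2 \<Rightarrow> 'w \<Rightarrow> real) \<Rightarrow> 'v measure \<Rightarrow> (real^2 \<Rightarrow> 'v \<Rightarrow> real) \<Rightarrow>
   real filter \<Rightarrow> bool" where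
  "converges_in_distribution M W N Y A \<longleftrightarrow>
     (\<forall>F. bounded_continuous_functional F \<longrightarrow>
        ((\<lambda>\<rho>. \<integral>\<omega>. F (\<lambda>u. W \<rho> u \<omega>) \<partial>M) \<longlongrightarrow> (\<integral>\<omega>. F (\<lambda>u. Y u \<omega>) \<partial>N)) A)"

definition has_tangent_field ::
  "real \<Rightarrow> 'w measure \<Rightarrow> (real^2 \<Rightarrow> 'w \<Rightarrow> real) \<Rightarrow> real^2 \<Rightarrow>
   'v measure \<Rightarrow> (real^2 \<Rightarrow> 'v \<Rightarrow> real) \<Rightarrow> bool" where
  "has_tangent_field H M Z x0 N Y \<longleftrightarrow>
     prob_space M \<and> prob_space N \<and>
     (\<exists>u. \<not> (AE \<omega> in N. Y u \<omega> = 0)) \<and>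
     (\<exists>Z' Y'. continuous_version M Z Z' \<and> continuous_version N Y Y' \<and>
        converges_in_distribution M
          (\<lambda>\<rho> u \<omega>. \<rho> powr (-H) * (Z' (x0 + \<rho> *\<^sub>R u) \<omega> - Z' x0 \<omega>)) N Y' (at_right 0))"

text \<open>
  The tangent field, hence its anisotropy function (almost everywhere on the circle), is unique in
  law only, so the local structure tensor is the unique \<open>J\<close> related to \<open>Z\<close> and \<open>x0\<close> below.
  The tangent field lives on an arbitrary probability space whose points are functions on the
  plane; the law of any random field can be realized on such a space, so this is no restriction.
\<close>

definition has_local_structure_tensor ::
  "real \<Rightarrow> 'w measure \<Rightarrow> (real^2 \<Rightarrow> 'w \<Rightarrow> real) \<Rightarrow> real^2 \<Rightarrow> real^2^2 \<Rightarrow> bool" where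
  "has_local_structure_tensor H M Z x0 J \<longleftrightarrow>
     (\<exists>(N :: (real^2 \<Rightarrow> real) measure) Y C.
        has_tangent_field H M Z x0 N Y \<and> self_similar_gaussian_field H N Y C \<and>
        J = structure_tensor C)"

definition approx_local_orientation ::
  "real \<Rightarrow> (real \<Rightarrow> 'w measure) \<Rightarrow> (real \<Rightarrow> real^2 \<Rightarrow> 'w \<Rightarrow> real) \<Rightarrow> real^2 \<Rightarrow> real^2 \<Rightarrow> bool" where
  "approx_local_orientation H M Z x0 m \<longleftrightarrow>
     norm m = 1 \<and>
     (\<exists>c>0. \<exists>J. (\<forall>\<delta>>0. has_local_structure_tensor H (M \<delta>) (Z \<delta>) x0 (J \<delta>)) \<and>
        (\<forall>k l. (\<lambda>\<delta>. J \<delta> $ k $ l - c * (m $ k * m $ l)) \<in> O[at_right 0](\<lambda>\<delta>. \<delta>\<^sup>2)))"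

end

theory Submission
  imports Defs
begin

text \<open>
  A Gaussian field with stationary increments and \<open>H\<close>-self-similarity has increments of variance at
  most \<open>K * norm (x - y) powr (2 * H)\<close>; Gaussian moments of high order and interpolation on dyadic
  grids then give a continuous version \<open>X'\<close> (Kolmogorov's criterion).  By stationarity and
  self-similarity, the rescaled increments of \<open>X' \<circ> g\<close> at \<open>x0\<close> have the same finite-dimensional laws
  as \<open>X'\<close> composed with the rescaled increments of \<open>g\<close>.  The latter converge locally uniformly to
  the differential \<open>A\<close> of \<open>g\<close>, so path continuity and dominated convergence show that the tangent
  field is \<open>X' \<circ> A\<close>, without any tightness argument.

  For \<open>g = \<Phi>\<close>, the differential is multiplication by \<open>exp (\<Psi> x0)\<close>, that is a rotation by
  \<open>- \<alpha> x0\<close> scaled by \<open>c = exp (lam x0)\<close>.  The tangent field therefore has the anisotropy function of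
  \<open>X\<close> rotated by \<open>\<alpha> x0\<close> and multiplied by \<open>c powr (2 * H)\<close>, and averaging
  \<open>\<Theta> \<mapsto> \<Theta> \<Theta>\<^sup>T\<close> over the two arcs of half-width \<open>\<delta>\<close> gives the rank one matrix
  up to \<open>\<delta>\<^sup>2\<close>, the first-order term being odd.
\<close>

subsection \<open>Finite-dimensional laws and Gaussian variables\<close>

lemma random_vector_measurable:
  fixes Y :: "real^2 \<Rightarrow> 'w \<Rightarrow> real"
  assumes "\<And>x. x \<in> S \<Longrightarrow> Y x \<in> borel_measurable M"
  shows "(\<lambda>\<omega>. \<lambda>x\<in>S. Y x \<omega>) \<in> measurable M (Pi\<^sub>M S (\<lambda>_. borel))"
  using assms by (intro measurable_restrict) auto

lemma same_fdd_sym: "same_fdd M Y Y' \<Longrightarrow> same_fdd M Y' Y"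
  by (simp add: same_fdd_def)

lemma same_fdd_trans: "same_fdd M Y Y' \<Longrightarrow> same_fdd M Y' Y'' \<Longrightarrow> same_fdd M Y Y''"
  by (simp add: same_fdd_def)

lemma same_fdd_AE:
  fixes Y Y' :: "real^2 \<Rightarrow> 'w \<Rightarrow> real"
  assumes [measurable]: "\<And>x. Y x \<in> borel_measurable M" "\<And>x. Y' x \<in> borel_measurable M"
    and ae: "\<And>x. AE \<omega> in M. Y x \<omega> = Y' x \<omega>"
  shows "same_fdd M Y Y'"
  unfolding same_fdd_def
proof (intro allI impI)
  fix S :: "(real^2) set" assume S: "finite S"
  have "AE \<omega> in M. \<forall>x\<in>S. Y x \<omega> = Y' x \<omega>"
    using ae S by (simp add: AE_finite_all)
  then have "AE \<omega> in M. (\<lambda>x\<in>S. Y x \<omega>) = (\<lambda>x\<in>S. Y' x \<omega>)"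
    by eventually_elim (auto simp: restrict_def)
  then show "distr M (Pi\<^sub>M S (\<lambda>_. borel)) (\<lambda>\<omega>. \<lambda>x\<in>S. Y x \<omega>) =
        distr M (Pi\<^sub>M S (\<lambda>_. borel)) (\<lambda>\<omega>. \<lambda>x\<in>S. Y' x \<omega>)"
    by (intro distr_cong_AE refl random_vector_measurable assms)
qed

text \<open>The vector over \<open>S\<close> is a measurable image of the vector over the points
  \<open>\<tau> x\<close> with \<open>x\<close> in \<open>S\<close>. Coordinates are read by name,
  so collisions \<open>\<tau> x = \<tau> y\<close> do no harm, and nonlinear substitutions can be
  inserted later.\<close>

lemma same_fdd_transform:
  fixes Y Y' :: "real^2 \<Rightarrow> 'w \<Rightarrow> real" and \<tau> :: "real^2 \<Rightarrow> real^2"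
  assumes [measurable]: "\<And>x. Y x \<in> borel_measurable M" "\<And>x. Y' x \<in> borel_measurable M"
    and fdd: "same_fdd M Y Y'"
  shows "same_fdd M (\<lambda>x \<omega>. c * Y (\<tau> x) \<omega>) (\<lambda>x \<omega>. c * Y' (\<tau> x) \<omega>)"
  unfolding same_fdd_def
proof (intro allI impI)
  fix S :: "(real^2) set" assume S: "finite S"
  let ?T = "\<tau> ` S"
  let ?f = "\<lambda>g. \<lambda>x\<in>S. c * g (\<tau> x) :: real"
  have f: "?f \<in> measurable (Pi\<^sub>M ?T (\<lambda>_. borel)) (Pi\<^sub>M S (\<lambda>_. borel))"
    by (intro measurable_restrict borel_measurable_times borel_measurable_const
        measurable_component_singleton) auto
  have *: "distr (distr M (Pi\<^sub>M ?T (\<lambda>_. borel)) (\<lambda>\<omega>. \<lambda>x\<in>?T. Z x \<omega>)) (Pi\<^sub>M S (\<lambda>_. borel)) ?f =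
      distr M (Pi\<^sub>M S (\<lambda>_. borel)) (\<lambda>\<omega>. \<lambda>x\<in>S. c * Z (\<tau> x) \<omega>)"
    if [measurable]: "\<And>x. Z x \<in> borel_measurable M" for Z :: "real^2 \<Rightarrow> 'w \<Rightarrow> real"
    by (subst distr_distr[OF f random_vector_measurable])
      (auto simp: o_def restrict_def fun_eq_iff that intro!: distr_cong)
  have "distr M (Pi\<^sub>M ?T (\<lambda>_. borel)) (\<lambda>\<omega>. \<lambda>x\<in>?T. Y x \<omega>) =
      distr M (Pi\<^sub>M ?T (\<lambda>_. borel)) (\<lambda>\<omega>. \<lambda>x\<in>?T. Y' x \<omega>)"
    using fdd S by (simp add: same_fdd_def)
  then show "distr M (Pi\<^sub>M S (\<lambda>_. borel)) (\<lambda>\<omega>. \<lambda>x\<in>S. c * Y (\<tau> x) \<omega>) =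
        distr M (Pi\<^sub>M S (\<lambda>_. borel)) (\<lambda>\<omega>. \<lambda>x\<in>S. c * Y' (\<tau> x) \<omega>)"
    using *[of Y] *[of Y'] by simp
qed

lemma same_fdd_integral:
  fixes Y Y' :: "real^2 \<Rightarrow> 'w \<Rightarrow> real" and f :: "(real^2 \<Rightarrow> real) \<Rightarrow> real"
  assumes [measurable]: "\<And>x. Y x \<in> borel_measurable M" "\<And>x. Y' x \<in> borel_measurable M"
    and fdd: "same_fdd M Y Y'" and S: "finite S"
    and f: "f \<in> borel_measurable (Pi\<^sub>M S (\<lambda>_. borel))"
  shows "(\<integral>\<omega>. f (\<lambda>x\<in>S. Y x \<omega>) \<partial>M) = (\<integral>\<omega>. f (\<lambda>x\<in>S. Y' x \<omega>) \<partial>M)"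
proof -
  have "(\<integral>\<omega>. f (\<lambda>x\<in>S. Z x \<omega>) \<partial>M) =
      (\<integral>g. f g \<partial>distr M (Pi\<^sub>M S (\<lambda>_. borel)) (\<lambda>\<omega>. \<lambda>x\<in>S. Z x \<omega>))"
    if [measurable]: "\<And>x. Z x \<in> borel_measurable M" for Z :: "real^2 \<Rightarrow> 'w \<Rightarrow> real"
    by (intro integral_distr[symmetric] random_vector_measurable that f)
  then show ?thesis
    using fdd S by (simp add: same_fdd_def)
qed

lemma same_fdd_integral_single:
  fixes Y Y' :: "real^2 \<Rightarrow> 'w \<Rightarrow> real" and f :: "real \<Rightarrow> real"
  assumes Y: "\<And>x. Y x \<in> borel_measurable M" "\<And>x. Y' x \<in> borel_measurable M"
    and fdd: "same_fdd M Y Y'" and f [measurable]: "f \<in> borel_measurable borel"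
  shows "(\<integral>\<omega>. f (Y x \<omega>) \<partial>M) = (\<integral>\<omega>. f (Y' x \<omega>) \<partial>M)"
proof -
  have "(\<lambda>g. f (g x)) \<in> borel_measurable (Pi\<^sub>M {x} (\<lambda>_. borel))"
    using measurable_compose[OF measurable_component_singleton[of x "{x}" "\<lambda>_. borel :: real measure"] f]
    by simp
  from same_fdd_integral[OF Y fdd _ this] show ?thesis
    by simp
qed

lemma same_fdd_distr:
  fixes Y Y' :: "real^2 \<Rightarrow> 'v \<Rightarrow> real"
  assumes T: "T \<in> measurable M N"
    and Y: "\<And>x. Y x \<in> borel_measurable N" "\<And>x. Y' x \<in> borel_measurable N"
    and fdd: "same_fdd M (\<lambda>x \<omega>. Y x (T \<omega>)) (\<lambda>x \<omega>. Y' x (T \<omega>))"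
  shows "same_fdd (distr M N T) Y Y'"
  unfolding same_fdd_def
proof (intro allI impI)
  fix S :: "(real^2) set" assume S: "finite S"
  have *: "distr (distr M N T) (Pi\<^sub>M S (\<lambda>_. borel)) (\<lambda>\<omega>. \<lambda>x\<in>S. Z x \<omega>) =
     distr M (Pi\<^sub>M S (\<lambda>_. borel)) (\<lambda>\<omega>. \<lambda>x\<in>S. Z x (T \<omega>))"
    if "\<And>x. Z x \<in> borel_measurable N" for Z :: "real^2 \<Rightarrow> 'v \<Rightarrow> real"
    using T that by (subst distr_distr) (auto simp: o_def intro!: random_vector_measurable)
  show "distr (distr M N T) (Pi\<^sub>M S (\<lambda>_. borel)) (\<lambda>\<omega>. \<lambda>x\<in>S. Y x \<omega>) =
        distr (distr M N T) (Pi\<^sub>M S (\<lambda>_. borel)) (\<lambda>\<omega>. \<lambda>x\<in>S. Y' x \<omega>)"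
    using fdd S by (simp add: * Y same_fdd_def)
qed

section \<open>Centered Gaussian variables and their even moments\<close>

lemma centered_gaussian_rv_cong_AE:
  assumes "centered_gaussian_rv M V" and V': "V' \<in> borel_measurable M"
    and ae: "AE \<omega> in M. V \<omega> = V' \<omega>"
  shows "centered_gaussian_rv M V'"
proof -
  have V: "V \<in> borel_measurable M" and
    d: "(AE \<omega> in M. V \<omega> = 0) \<or> (\<exists>\<sigma>>0. distributed M lborel V (normal_density 0 \<sigma>))"
    using assms(1) by (auto simp: centered_gaussian_rv_def)
  from d show ?thesis
  proof
    assume "AE \<omega> in M. V \<omega> = 0"
    with ae have "AE \<omega> in M. V' \<omega> = 0" by eventually_elim simp
    with V' show ?thesis by (simp add: centered_gaussian_rv_def)
  next
    assume "\<exists>\<sigma>>0. distributed M lborel V (normal_density 0 \<sigma>)"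
    moreover have "distr M lborel V = distr M lborel V'"
      using V V' ae by (intro distr_cong_AE) auto
    ultimately show ?thesis
      using V' by (auto simp: centered_gaussian_rv_def distributed_def)
  qed
qed

lemma centered_gaussian_rv_distr:
  assumes T: "T \<in> measurable M N" and V: "V \<in> borel_measurable N"
    and g: "centered_gaussian_rv M (\<lambda>\<omega>. V (T \<omega>))"
  shows "centered_gaussian_rv (distr M N T) V"
proof -
  have d: "distr (distr M N T) lborel V = distr M lborel (\<lambda>\<omega>. V (T \<omega>))"
    using T V by (subst distr_distr) (auto simp: o_def)
  have ae: "(AE \<omega> in distr M N T. V \<omega> = 0) \<longleftrightarrow> (AE \<omega> in M. V (T \<omega>) = 0)"
    using V by (intro AE_distr_iff[OF T]) measurable
  show ?thesis
    using g V T by (auto simp: centered_gaussian_rv_def distributed_def d ae)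
qed

text \<open>A variance bound thereby controls moments of every even order, as Kolmogorov's criterion
  needs when \<open>H\<close> is small. The degenerate case obeys the same formula with variance
  zero.\<close>

lemma centered_gaussian_rv_even_moment:
  assumes "centered_gaussian_rv M V" "prob_space M"
  shows "integrable M (\<lambda>\<omega>. V \<omega> ^ (2 * k))" (is ?A)
    and "(\<integral>\<omega>. V \<omega> ^ (2 * k) \<partial>M) = fact (2 * k) / (2 ^ k * fact k) * (\<integral>\<omega>. (V \<omega>)\<^sup>2 \<partial>M) ^ k" (is ?B)
proof -
  interpret prob_space M by fact
  have V [measurable]: "V \<in> borel_measurable M" and
    d: "(AE \<omega> in M. V \<omega> = 0) \<or> (\<exists>\<sigma>>0. distributed M lborel V (normal_density 0 \<sigma>))"
    using assms(1) by (auto simp: centered_gaussian_rv_def)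
  from d have "?A \<and> ?B"
  proof
    assume ae: "AE \<omega> in M. V \<omega> = 0"
    \<comment> \<open>Written \<open>0 ^ (2 * j)\<close> rather than \<open>0\<close> so that
      \<open>j = 0\<close> is covered, where both sides are \<open>1\<close>.\<close>
    have 1: "AE \<omega> in M. V \<omega> ^ (2 * j) = 0 ^ (2 * j)" for j
      using ae by eventually_elim simp
    have 2: "integrable M (\<lambda>\<omega>. V \<omega> ^ (2 * j))" for j
      by (subst integrable_cong_AE[OF _ _ 1]) auto
    have 3: "(\<integral>\<omega>. V \<omega> ^ (2 * j) \<partial>M) = 0 ^ (2 * j)" for j
      by (subst integral_cong_AE[OF _ _ 1]) (auto simp: prob_space)
    have "(\<integral>\<omega>. (V \<omega>)\<^sup>2 \<partial>M) = 0"
      using 3[of 1] by simp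
    then show ?thesis
      using 2[of k] 3[of k] by (cases "k = 0") (simp_all add: power_0_left)
  next
    assume "\<exists>\<sigma>>0. distributed M lborel V (normal_density 0 \<sigma>)"
    then obtain \<sigma> where s: "\<sigma> > 0" and D: "distributed M lborel V (normal_density 0 \<sigma>)" by blast
    note m = normal_moment_even[OF s, of 0]
    have 2: "integrable M (\<lambda>\<omega>. V \<omega> ^ (2 * j))" for j
      using distributed_integrable[OF D, of "\<lambda>x. x ^ (2 * j)"]
        integrable.intros[OF m[of j]] by simp
    have 3: "(\<integral>\<omega>. V \<omega> ^ (2 * j) \<partial>M) = fact (2 * j) / ((2 / \<sigma>\<^sup>2)^j * fact j)" for j
      using distributed_integral[OF D, of "\<lambda>x. x ^ (2 * j)"]
        has_bochner_integral_integral_eq[OF m[of j]] by simp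
    have "(\<integral>\<omega>. V \<omega> ^ (2 * 1) \<partial>M) = \<sigma>\<^sup>2"
      unfolding 3 using s by (simp add: divide_simps)
    then have "(\<integral>\<omega>. (V \<omega>)\<^sup>2 \<partial>M) = \<sigma>\<^sup>2"
      by simp
    then show ?thesis
      using 2[of k] 3[of k] by (simp add: power_divide)
  qed
  then show ?A ?B by auto
qed

lemma gaussian_fieldD:
  "gaussian_field M Y \<Longrightarrow> finite S \<Longrightarrow> centered_gaussian_rv M (\<lambda>\<omega>. \<Sum>x\<in>S. a x * Y x \<omega>)"
  by (simp add: gaussian_field_def)

lemma gaussian_field_single:
  assumes "gaussian_field M Y"
  shows "centered_gaussian_rv M (Y x)"
  using gaussian_fieldD[OF assms, of "{x}" "\<lambda>_. 1"] by simp

lemma gaussian_field_measurable: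
  assumes "gaussian_field M Y"
  shows "Y x \<in> borel_measurable M"
  using gaussian_field_single[OF assms, of x] by (simp add: centered_gaussian_rv_def)

lemma gaussian_field_diff:
  assumes "gaussian_field M Y"
  shows "centered_gaussian_rv M (\<lambda>\<omega>. Y x \<omega> - Y y \<omega>)"
proof (cases "x = y")
  case True
  then show ?thesis by (simp add: centered_gaussian_rv_def)
next
  case False
  then show ?thesis
    using gaussian_fieldD[OF assms, of "{x, y}" "\<lambda>z. if z = x then 1 else -1"] by simp
qed

text \<open>Points with the same image under \<open>\<tau>\<close> are grouped and their
  coefficients added, which leaves a linear combination of \<open>Y\<close> over distinct
  points.\<close>

lemma gaussian_field_compose:
  fixes \<tau> :: "real^2 \<Rightarrow> real^2"
  assumes "gaussian_field M Y"
  shows "gaussian_field M (\<lambda>x. Y (\<tau> x))"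
  unfolding gaussian_field_def
proof (intro allI impI)
  fix S :: "(real^2) set" and a assume S: "finite S"
  have "(\<Sum>x\<in>S. a x * Y (\<tau> x) \<omega>) = (\<Sum>y\<in>\<tau> ` S. (\<Sum>x | x \<in> S \<and> \<tau> x = y. a x) * Y y \<omega>)" for \<omega>
  proof -
    have "(\<Sum>x\<in>S. a x * Y (\<tau> x) \<omega>) = (\<Sum>y\<in>\<tau> ` S. \<Sum>x | x \<in> S \<and> \<tau> x = y. a x * Y (\<tau> x) \<omega>)"
      using S by (rule sum.image_gen)
    then show ?thesis by (auto simp: sum_distrib_right intro!: sum.cong)
  qed
  then show "centered_gaussian_rv M (\<lambda>\<omega>. \<Sum>x\<in>S. a x * Y (\<tau> x) \<omega>)"
    using assms S by (simp add: gaussian_field_def)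
qed

subsection \<open>Interpolation on dyadic grids\<close>

text \<open>The mesh is \<open>1 / 2 ^ n\<close> and the half-side of the square is
  \<open>4 ^ n / 2 ^ n = 2 ^ n\<close>, so increasing \<open>n\<close> refines the grid and exhausts
  the plane at once.\<close>

definition dyadic_grid :: "nat \<Rightarrow> (real^2) set" where
  "dyadic_grid n = (\<lambda>(i, j). vector [of_int i / 2 ^ n, of_int j / 2 ^ n]) ` ({-(4 ^ n)..4 ^ n :: int} \<times> {-(4 ^ n)..4 ^ n :: int})"

definition hat :: "nat \<Rightarrow> real^2 \<Rightarrow> real^2 \<Rightarrow> real" where
  "hat n s x = max 0 (2 / 2 ^ n - dist x s)"

text \<open>The second summand only matters outside the ball of radius \<open>2 ^ n\<close>, where it keeps the
  denominator positive.\<close>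

definition total_weight :: "nat \<Rightarrow> real^2 \<Rightarrow> real" where
  "total_weight n x = (\<Sum>s\<in>dyadic_grid n. hat n s x) + max 0 (norm x - 2 ^ n)"

text \<open>A normalised partition of unity: on the ball of radius \<open>2 ^ n\<close> the value at
  \<open>x\<close> is a weighted mean of nearby grid values. It need not reproduce \<open>g\<close>
  at grid points; what matters is that it is continuous and reads finitely many values.\<close>

definition interp :: "nat \<Rightarrow> (real^2 \<Rightarrow> real) \<Rightarrow> real^2 \<Rightarrow> real" where
  "interp n g x = (\<Sum>s\<in>dyadic_grid n. g s * hat n s x) / total_weight n x"

lemma finite_dyadic_grid: "finite (dyadic_grid n)"
  by (simp add: dyadic_grid_def)

lemma card_dyadic_grid: "card (dyadic_grid n) \<le> 9 * 16 ^ n"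
proof -
  have "nat (2 * 4 ^ n + 1) \<le> 3 * 4 ^ n"
    by (simp add: nat_le_iff)
  then have c: "card {-(4 ^ n)..4 ^ n :: int} \<le> 3 * 4 ^ n"
    by (simp add: add.commute)
  have "card (dyadic_grid n) \<le> card ({-(4 ^ n)..4 ^ n :: int} \<times> {-(4 ^ n)..4 ^ n :: int})"
    unfolding dyadic_grid_def by (intro card_image_le) auto
  also have "\<dots> = card {-(4 ^ n)..4 ^ n :: int} * card {-(4 ^ n)..4 ^ n :: int}"
    by (rule card_cartesian_product)
  also have "\<dots> \<le> (3 * 4 ^ n) * (3 * 4 ^ n)"
    by (intro mult_mono c) auto
  also have "\<dots> = 9 * 16 ^ n"
    by (simp add: power_mult_distrib[symmetric] mult.assoc)
  finally show ?thesis .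
qed

text \<open>Round each coordinate down to the grid: each error is below one mesh, and their sum
  bounds the distance.\<close>

lemma dyadic_grid_near:
  assumes "norm x \<le> 2 ^ n"
  obtains s where "s \<in> dyadic_grid n" "dist x s < 2 / 2 ^ n"
proof -
  have k: "\<bar>x $ k\<bar> \<le> 2 ^ n" for k
    using component_le_norm_cart[of x k] assms by linarith
  define i where "i k = \<lfloor>2 ^ n * x $ k\<rfloor>" for k
  have 4: "(4::real) ^ n = 2 ^ n * 2 ^ n"
    by (simp add: power_mult_distrib[symmetric])
  have i: "i k \<in> {-(4 ^ n)..4 ^ n}" for k
  proof -
    have "\<bar>2 ^ n * x $ k\<bar> \<le> 4 ^ n"
      using k[of k] by (simp add: abs_mult 4)
    then have "- (4 ^ n) \<le> 2 ^ n * x $ k" "2 ^ n * x $ k \<le> 4 ^ n"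
      by linarith+
    then have "of_int (- (4 ^ n)) \<le> 2 ^ n * x $ k" "2 ^ n * x $ k \<le> of_int (4 ^ n)"
      by simp_all
    then show ?thesis
      unfolding i_def atLeastAtMost_iff le_floor_iff by linarith
  qed
  define s :: "real^2" where "s = vector [of_int (i 1) / 2 ^ n, of_int (i 2) / 2 ^ n]"
  have "s \<in> dyadic_grid n"
    unfolding dyadic_grid_def s_def using i by (intro image_eqI[where x = "(i 1, i 2)"]) auto
  moreover have "dist x s < 2 / 2 ^ n"
  proof -
    have b: "\<bar>x $ k - of_int (i k) / 2 ^ n\<bar> < 1 / 2 ^ n" for k
    proof -
      have "\<bar>2 ^ n * x $ k - of_int (i k)\<bar> < 1"
        unfolding i_def by linarith
      then have "\<bar>2 ^ n * x $ k - of_int (i k)\<bar> / 2 ^ n < 1 / 2 ^ n"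
        by (intro divide_strict_right_mono) auto
      also have "\<bar>2 ^ n * x $ k - of_int (i k)\<bar> / 2 ^ n = \<bar>(2 ^ n * x $ k - of_int (i k)) / 2 ^ n\<bar>"
        by simp
      also have "(2 ^ n * x $ k - of_int (i k)) / 2 ^ n = x $ k - of_int (i k) / 2 ^ n"
        by (simp add: diff_divide_distrib)
      finally show ?thesis .
    qed
    have "dist x s \<le> (\<Sum>k\<in>UNIV. \<bar>(x - s) $ k\<bar>)"
      unfolding dist_norm by (rule norm_le_l1_cart)
    also have "\<dots> < 1 / 2 ^ n + 1 / 2 ^ n"
      unfolding sum_2 using b[of 1] b[of 2] by (intro add_strict_mono) (simp_all add: s_def)
    finally show ?thesis by simp
  qed
  ultimately show thesis using that by blast
qed

lemma hat_nonneg: "hat n s x \<ge> 0"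
  by (simp add: hat_def)

lemma hat_pos_iff: "hat n s x > 0 \<longleftrightarrow> dist x s < 2 / 2 ^ n"
  by (auto simp: hat_def)

lemma sum_hat_pos:
  assumes "norm x \<le> 2 ^ n"
  shows "(\<Sum>s\<in>dyadic_grid n. hat n s x) > 0"
proof -
  obtain s where "s \<in> dyadic_grid n" "dist x s < 2 / 2 ^ n"
    using dyadic_grid_near[OF assms] .
  then show ?thesis
    by (intro sum_pos2[of _ s] finite_dyadic_grid) (auto simp: hat_nonneg hat_pos_iff)
qed

lemma total_weight_pos: "total_weight n x > 0"
proof (cases "norm x \<le> 2 ^ n")
  case True
  then show ?thesis using sum_hat_pos[of x n] by (simp add: total_weight_def)
next
  case False
  then show ?thesis
    unfolding total_weight_def by (intro add_nonneg_pos sum_nonneg hat_nonneg) auto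
qed

lemma continuous_on_interp: "continuous_on UNIV (interp n g)"
  unfolding interp_def
  by (intro continuous_intros less_imp_neq[OF total_weight_pos, symmetric] ballI)
    (auto simp: hat_def total_weight_def intro!: continuous_intros)

text \<open>A weighted mean of numbers within \<open>e\<close> of \<open>c\<close> is itself within
  \<open>e\<close> of \<open>c\<close>, and only grid points whose cone contains \<open>x\<close>
  have positive weight.\<close>

lemma interp_close:
  assumes x: "norm x \<le> 2 ^ n"
    and g: "\<And>s. s \<in> dyadic_grid n \<Longrightarrow> dist x s < 2 / 2 ^ n \<Longrightarrow> \<bar>g s - c\<bar> \<le> e"
  shows "\<bar>interp n g x - c\<bar> \<le> e"
proof -
  let ?D = "\<Sum>s\<in>dyadic_grid n. hat n s x"
  have D: "?D > 0" and t: "total_weight n x = ?D"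
    using sum_hat_pos[OF x] x by (auto simp: total_weight_def)
  have "interp n g x - c = (\<Sum>s\<in>dyadic_grid n. (g s - c) * hat n s x) / ?D"
    using D by (simp add: interp_def t left_diff_distrib sum_subtractf sum_distrib_left[symmetric]
      diff_divide_distrib)
  also have "\<bar>\<dots>\<bar> \<le> (\<Sum>s\<in>dyadic_grid n. e * hat n s x) / ?D"
    unfolding abs_divide using D
  proof (intro frac_le order.trans[OF sum_abs] sum_mono)
    show "\<bar>(g s - c) * hat n s x\<bar> \<le> e * hat n s x" if "s \<in> dyadic_grid n" for s
    proof (cases "hat n s x = 0")
      case False
      then have "dist x s < 2 / 2 ^ n"
        using hat_nonneg[of n s x] by (simp add: hat_pos_iff[symmetric])
      with g[OF that] hat_nonneg[of n s x] show ?thesis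
        by (simp add: abs_mult mult_right_mono)
    qed simp
    obtain s where s: "s \<in> dyadic_grid n" "dist x s < 2 / 2 ^ n"
      using dyadic_grid_near[OF x] .
    have "0 \<le> e" using g[OF s] by linarith
    then show "0 \<le> (\<Sum>s\<in>dyadic_grid n. e * hat n s x)"
      by (intro sum_nonneg mult_nonneg_nonneg hat_nonneg)
  qed auto
  also have "\<dots> = e"
    using D by (simp add: sum_distrib_left[symmetric])
  finally show ?thesis .
qed

text \<open>Two applications of \<open>interp_close\<close>: a coarse and a fine grid point whose
  cones contain \<open>x\<close> are less than \<open>2 / 2 ^ n + 1 / 2 ^ n\<close> apart, hence
  within the allowed \<open>4 / 2 ^ n\<close>.\<close>

lemma interp_step:
  assumes x: "norm x \<le> 2 ^ n"
    and g: "\<And>s t. s \<in> dyadic_grid n \<Longrightarrow> t \<in> dyadic_grid (Suc n) \<Longrightarrow> dist s t < 4 / 2 ^ n \<Longrightarrow>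
      \<bar>g s - g t\<bar> \<le> e"
  shows "\<bar>interp (Suc n) g x - interp n g x\<bar> \<le> e"
proof (rule interp_close)
  show "norm x \<le> 2 ^ Suc n"
    using x by (rule order.trans) simp
  fix t assume t: "t \<in> dyadic_grid (Suc n)" "dist x t < 2 / 2 ^ Suc n"
  have "\<bar>interp n g x - g t\<bar> \<le> e"
  proof (rule interp_close[OF x])
    fix s assume s: "s \<in> dyadic_grid n" "dist x s < 2 / 2 ^ n"
    have "2 / 2 ^ Suc n \<le> (2 / 2 ^ n :: real)"
      by (simp add: divide_simps)
    then have "dist s t < 4 / 2 ^ n"
      using dist_triangle3[of s t x] s(2) t(2) by simp
    then show "\<bar>g s - g t\<bar> \<le> e"
      using g s(1) t(1) by blast
  qed
  then show "\<bar>g t - interp n g x\<bar> \<le> e"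
    by (simp add: abs_minus_commute)
qed

lemma two_power_ge_norm: "eventually (\<lambda>n. R \<le> (2::real) ^ n) sequentially"
proof -
  obtain N where "R < 2 ^ N" using real_arch_pow[of 2 R] by auto
  then have "R \<le> 2 ^ n" if "n \<ge> N" for n
    using power_increasing[OF that, of "2::real"] by linarith
  then show ?thesis by (auto simp: eventually_sequentially)
qed

lemma two_over_two_power_less:
  assumes "d > 0"
  shows "eventually (\<lambda>n. 2 / 2 ^ n < (d::real)) sequentially"
proof -
  have "(\<lambda>n. 2 * (1 / 2) ^ n :: real) \<longlonglongrightarrow> 2 * 0"
    by (intro tendsto_intros LIMSEQ_realpow_zero) auto
  then show ?thesis
    using order_tendstoD(2)[of "\<lambda>n. 2 * (1 / 2) ^ n :: real" 0 sequentially d] assms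
    by (simp add: power_divide)
qed

lemma interp_uniform_limit:
  assumes g: "continuous_on UNIV g" and K: "compact K"
  shows "uniform_limit K (\<lambda>n. interp n g) g sequentially"
proof (rule uniform_limitI)
  fix e :: real assume e: "e > 0"
  obtain R where R: "\<And>x. x \<in> K \<Longrightarrow> norm x \<le> R"
    using compact_imp_bounded[OF K] by (auto simp: bounded_iff)
  \<comment> \<open>The radius is enlarged by \<open>1\<close> because the grid points used near
    \<open>K\<close> may lie outside \<open>K\<close>.\<close>
  have "uniformly_continuous_on (cball 0 (R + 1)) g"
    by (intro compact_uniformly_continuous continuous_on_subset[OF g]) auto
  then obtain d where d: "d > 0" and
    gd: "\<And>x y. x \<in> cball 0 (R + 1) \<Longrightarrow> y \<in> cball 0 (R + 1) \<Longrightarrow> dist y x < d \<Longrightarrow> dist (g y) (g x) < e / 2"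
    unfolding uniformly_continuous_on_def using e by (metis half_gt_zero)
  have "eventually (\<lambda>n. 2 / 2 ^ n < min d 1) sequentially"
    using d by (intro two_over_two_power_less) auto
  with two_power_ge_norm[of R]
  show "\<forall>\<^sub>F n in sequentially. \<forall>x\<in>K. dist (interp n g x) (g x) < e"
  proof eventually_elim
    case (elim n)
    show ?case
    proof
      fix x assume x: "x \<in> K"
      have "\<bar>interp n g x - g x\<bar> \<le> e / 2"
      proof (rule interp_close)
        show "norm x \<le> 2 ^ n" using R[OF x] elim by simp
        fix s assume s: "dist x s < 2 / 2 ^ n"
        then have "norm s \<le> R + 1"
          using elim R[OF x] norm_triangle_ineq2[of s x]
          unfolding dist_norm norm_minus_commute[of x s] min_less_iff_conj by linarith
        then have "dist (g s) (g x) < e / 2"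
          using gd[of x s] R[OF x] s elim by (simp add: dist_commute)
        then show "\<bar>g s - g x\<bar> \<le> e / 2" by (simp add: dist_real_def)
      qed
      then show "dist (interp n g x) (g x) < e" using e by (simp add: dist_real_def)
    qed
  qed
qed

subsection \<open>Continuous functionals of random fields\<close>

lemma bounded_continuous_functionalD:
  assumes "bounded_continuous_functional F"
  shows "\<exists>B. \<forall>g. continuous_on UNIV g \<longrightarrow> \<bar>F g\<bar> \<le> B"
    and "\<lbrakk>\<And>n. continuous_on UNIV (g n); continuous_on UNIV h;
      \<And>K. compact K \<Longrightarrow> uniform_limit K g h sequentially\<rbrakk> \<Longrightarrow> (\<lambda>n. F (g n)) \<longlonglongrightarrow> F h"
  using assms unfolding bounded_continuous_functional_def by blast+

text \<open>Since \<open>interp n g\<close> reads only grid values, this approximates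
  \<open>F\<close> by functionals of finitely many coordinates. Measurability and equality of laws
  on path space both rest on it.\<close>

lemma functional_interp_limit:
  assumes "bounded_continuous_functional F" "continuous_on UNIV g"
  shows "(\<lambda>n. F (interp n g)) \<longlonglongrightarrow> F g"
  using assms by (intro bounded_continuous_functionalD continuous_on_interp interp_uniform_limit)

lemma interp_cong: "(\<And>s. s \<in> dyadic_grid n \<Longrightarrow> g s = g' s) \<Longrightarrow> interp n g = interp n g'"
  by (simp add: interp_def fun_eq_iff)

lemma uniform_limit_sum_finite:
  fixes f :: "'i \<Rightarrow> nat \<Rightarrow> 'a \<Rightarrow> real"
  assumes "finite I" "\<And>i. i \<in> I \<Longrightarrow> uniform_limit K (f i) (l i) sequentially"
  shows "uniform_limit K (\<lambda>k x. \<Sum>i\<in>I. f i k x) (\<lambda>x. \<Sum>i\<in>I. l i x) sequentially"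
  using assms by (induction I rule: finite_induct) (auto intro!: uniform_limit_intros)

text \<open>For fixed \<open>n\<close> the interpolation is a finite sum of grid values times fixed
  continuous functions, so convergence at the grid points becomes uniform on compact sets.\<close>

lemma interp_tendsto_uniform:
  assumes lim: "\<And>s. s \<in> dyadic_grid n \<Longrightarrow> (\<lambda>k. g k s) \<longlonglongrightarrow> g' s" and K: "compact K"
  shows "uniform_limit K (\<lambda>k. interp n (g k)) (interp n g') sequentially"
proof -
  have c: "continuous_on K (\<lambda>x. hat n s x / total_weight n x)" for s
    by (intro continuous_intros less_imp_neq[OF total_weight_pos, symmetric] ballI)
      (auto simp: hat_def total_weight_def intro!: continuous_intros)
  have eq: "interp n h x = (\<Sum>s\<in>dyadic_grid n. h s * (hat n s x / total_weight n x))" for h x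
    by (simp add: interp_def sum_divide_distrib)
  have "uniform_limit K (\<lambda>k x. g k s * (hat n s x / total_weight n x))
      (\<lambda>x. g' s * (hat n s x / total_weight n x)) sequentially" if s: "s \<in> dyadic_grid n" for s
  proof (rule uniform_lim_mult)
    show "uniform_limit K (\<lambda>k x. g k s) (\<lambda>x. g' s) sequentially"
      using lim[OF s] by (simp add: uniform_limit_iff tendsto_iff eventually_mono)
    show "uniform_limit K (\<lambda>k x. hat n s x / total_weight n x) (\<lambda>x. hat n s x / total_weight n x) sequentially"
      by (rule uniform_limit_const)
    show "bounded ((\<lambda>x. g' s) ` K)"
      by (rule bounded_subset[of "{g' s}"]) auto
    show "bounded ((\<lambda>x. hat n s x / total_weight n x) ` K)"
      by (intro compact_imp_bounded compact_continuous_image c K)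
  qed
  then show ?thesis
    unfolding eq by (intro uniform_limit_sum_finite finite_dyadic_grid)
qed

text \<open>Measurability comes from continuity: by sequential continuity of \<open>F\<close>, the
  expression is a continuous function of the finitely many grid values.\<close>

lemma functional_interp_measurable:
  assumes F: "bounded_continuous_functional F"
    and W: "\<And>x. x \<in> dyadic_grid n \<Longrightarrow> W x \<in> borel_measurable M"
  shows "(\<lambda>\<omega>. F (interp n (\<lambda>x. W x \<omega>))) \<in> borel_measurable M"
proof -
  \<comment> \<open>The grid is coded by natural numbers because on a countable product of real
    lines the product sigma-algebra is the Borel sigma-algebra.\<close>
  obtain e :: "real^2 \<Rightarrow> nat" where e: "inj_on e (dyadic_grid n)"
    using finite_imp_inj_to_nat_seg[OF finite_dyadic_grid] by blast
  define h where "h a = F (interp n (\<lambda>s. a (e s)))" for a :: "nat \<Rightarrow> real"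
  have "continuous_on UNIV h"
  proof (subst continuous_on_sequentially, intro allI ballI impI, elim conjE)
    fix a and l :: "nat \<Rightarrow> real" assume "a \<longlonglongrightarrow> l"
    then have l: "(\<lambda>k. a k i) \<longlonglongrightarrow> l i" for i
      using continuous_on_tendsto_compose[OF continuous_on_product_coordinates[of i] \<open>a \<longlonglongrightarrow> l\<close>] by simp
    have "(\<lambda>k. h (a k)) \<longlonglongrightarrow> h l"
      unfolding h_def
      by (intro bounded_continuous_functionalD[OF F] continuous_on_interp interp_tendsto_uniform l)
    then show "(h \<circ> a) \<longlonglongrightarrow> h l" by (simp add: o_def)
  qed
  then have h: "h \<in> borel_measurable (Pi\<^sub>M UNIV (\<lambda>_. borel))"
    using borel_measurable_continuous_onI measurable_cong_sets[OF sets_PiM_equal_borel refl] by blast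
  let ?V = "\<lambda>\<omega> i. if i \<in> e ` dyadic_grid n then W (the_inv_into (dyadic_grid n) e i) \<omega> else 0"
  have "(\<lambda>\<omega>. \<lambda>i\<in>UNIV. ?V \<omega> i) \<in> measurable M (Pi\<^sub>M UNIV (\<lambda>_. borel))"
  proof (rule measurable_restrict)
    fix i
    show "(\<lambda>\<omega>. ?V \<omega> i) \<in> borel_measurable M"
      using the_inv_into_into[OF e _ subset_refl, of i]
      by (cases "i \<in> e ` dyadic_grid n") (auto intro: W)
  qed
  then have V: "?V \<in> measurable M (Pi\<^sub>M UNIV (\<lambda>_. borel))"
    by (simp add: restrict_def)
  have "h (?V \<omega>) = F (interp n (\<lambda>x. W x \<omega>))" for \<omega>
    unfolding h_def using e by (intro arg_cong[where f = F] interp_cong) (simp add: the_inv_into_f_f)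
  then show ?thesis
    using measurable_compose[OF V h] by simp
qed

lemma functional_measurable:
  assumes F: "bounded_continuous_functional F"
    and W: "\<And>x. W x \<in> borel_measurable M"
    and c: "\<And>\<omega>. \<omega> \<in> space M \<Longrightarrow> continuous_on UNIV (\<lambda>x. W x \<omega>)"
  shows "(\<lambda>\<omega>. F (\<lambda>x. W x \<omega>)) \<in> borel_measurable M"
  by (rule borel_measurable_LIMSEQ_real[OF functional_interp_limit[OF F c]
      functional_interp_measurable[OF F W]])

lemma functional_integral_interp_limit:
  assumes M: "finite_measure M" and F: "bounded_continuous_functional F"
    and W: "\<And>x. W x \<in> borel_measurable M"
    and c: "\<And>\<omega>. \<omega> \<in> space M \<Longrightarrow> continuous_on UNIV (\<lambda>x. W x \<omega>)"
  shows "(\<lambda>n. \<integral>\<omega>. F (interp n (\<lambda>x. W x \<omega>)) \<partial>M) \<longlonglongrightarrow> (\<integral>\<omega>. F (\<lambda>x. W x \<omega>) \<partial>M)"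
proof -
  interpret finite_measure M by fact
  obtain B where B: "\<And>g. continuous_on UNIV g \<Longrightarrow> \<bar>F g\<bar> \<le> B"
    using bounded_continuous_functionalD(1)[OF F] by blast
  show ?thesis
  proof (rule integral_dominated_convergence[where w = "\<lambda>_. B"])
    show "(\<lambda>\<omega>. F (\<lambda>x. W x \<omega>)) \<in> borel_measurable M"
      by (rule functional_measurable[OF F W c])
    show "(\<lambda>\<omega>. F (interp n (\<lambda>x. W x \<omega>))) \<in> borel_measurable M" for n
      by (rule functional_interp_measurable[OF F W])
    show "AE \<omega> in M. (\<lambda>n. F (interp n (\<lambda>x. W x \<omega>))) \<longlonglongrightarrow> F (\<lambda>x. W x \<omega>)"
      by (intro AE_I2 functional_interp_limit F c)
    show "AE \<omega> in M. norm (F (interp n (\<lambda>x. W x \<omega>))) \<le> B" for n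
      by (simp add: B continuous_on_interp)
  qed simp
qed

text \<open>Finite-dimensional laws determine the law on path space: the two integrals agree for
  each interpolation, and both sides pass to the limit.\<close>

lemma same_fdd_functional_integral:
  assumes M: "finite_measure M" and F: "bounded_continuous_functional F"
    and W: "\<And>x. W x \<in> borel_measurable M" "\<And>x. W' x \<in> borel_measurable M"
    and c: "\<And>\<omega>. \<omega> \<in> space M \<Longrightarrow> continuous_on UNIV (\<lambda>x. W x \<omega>)"
      "\<And>\<omega>. \<omega> \<in> space M \<Longrightarrow> continuous_on UNIV (\<lambda>x. W' x \<omega>)"
    and fdd: "same_fdd M W W'"
  shows "(\<integral>\<omega>. F (\<lambda>x. W x \<omega>) \<partial>M) = (\<integral>\<omega>. F (\<lambda>x. W' x \<omega>) \<partial>M)"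
proof -
  have "(\<integral>\<omega>. F (interp n (\<lambda>x. W x \<omega>)) \<partial>M) = (\<integral>\<omega>. F (interp n (\<lambda>x. W' x \<omega>)) \<partial>M)" for n
  proof -
    have m: "(\<lambda>g. F (interp n g)) \<in> borel_measurable (Pi\<^sub>M (dyadic_grid n) (\<lambda>_. borel))"
      using functional_interp_measurable[OF F, of n "\<lambda>x g. g x" "Pi\<^sub>M (dyadic_grid n) (\<lambda>_. borel)"]
      by (simp add: measurable_component_singleton)
    have r: "interp n (\<lambda>x\<in>dyadic_grid n. g x) = interp n g" for g
      by (rule interp_cong) simp
    show ?thesis
      using same_fdd_integral[OF W fdd finite_dyadic_grid m] by (simp add: r)
  qed
  then show ?thesis
    using functional_integral_interp_limit[OF M F W(1) c(1)]
      functional_integral_interp_limit[OF M F W(2) c(2)] LIMSEQ_unique by simp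
qed

text \<open>This takes the place of tightness: the field is fixed and only its arguments move, so
  each path composed with \<open>\<phi> n\<close> converges locally uniformly and the bound of
  \<open>F\<close> dominates.\<close>

lemma functional_integral_uniform_limit:
  fixes W :: "real^2 \<Rightarrow> 'w \<Rightarrow> real" and \<phi> :: "nat \<Rightarrow> real^2 \<Rightarrow> real^2"
  assumes M: "finite_measure M" and F: "bounded_continuous_functional F"
    and W: "\<And>x. W x \<in> borel_measurable M"
    and c: "\<And>\<omega>. \<omega> \<in> space M \<Longrightarrow> continuous_on UNIV (\<lambda>x. W x \<omega>)"
    and \<phi>: "\<And>n. continuous_on UNIV (\<phi> n)" "continuous_on UNIV \<phi>'"
    and lim: "\<And>K. compact K \<Longrightarrow> uniform_limit K \<phi> \<phi>' sequentially"
  shows "(\<lambda>n. \<integral>\<omega>. F (\<lambda>x. W (\<phi> n x) \<omega>) \<partial>M) \<longlonglongrightarrow> (\<integral>\<omega>. F (\<lambda>x. W (\<phi>' x) \<omega>) \<partial>M)"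
proof -
  interpret finite_measure M by fact
  obtain B where B: "\<And>g. continuous_on UNIV g \<Longrightarrow> \<bar>F g\<bar> \<le> B"
    using bounded_continuous_functionalD(1)[OF F] by blast
  have cc: "continuous_on UNIV (\<lambda>x. W (\<psi> x) \<omega>)" if "\<omega> \<in> space M" "continuous_on UNIV \<psi>" for \<omega> and \<psi> :: "real^2 \<Rightarrow> real^2"
    using continuous_on_compose2[OF c[OF that(1)] that(2)] by auto
  have u: "uniform_limit K (\<lambda>n x. W (\<phi> n x) \<omega>) (\<lambda>x. W (\<phi>' x) \<omega>) sequentially"
    if \<omega>: "\<omega> \<in> space M" and K: "compact K" for \<omega> K
  proof -
    have "compact (\<phi>' ` K)"
      by (intro compact_continuous_image continuous_on_subset[OF \<phi>(2)] K) auto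
    then obtain R where R: "\<And>x. x \<in> K \<Longrightarrow> norm (\<phi>' x) \<le> R"
      using compact_imp_bounded by (fastforce simp: bounded_iff)
    \<comment> \<open>Eventually all points \<open>\<phi> n x\<close> lie in one ball, on which the
      path is uniformly continuous.\<close>
    have ev: "\<forall>\<^sub>F n in sequentially. \<forall>x\<in>K. \<phi> n x \<in> cball 0 (R + 1)"
      using uniform_limitD[OF lim[OF K], of 1, OF zero_less_one]
    proof eventually_elim
      case (elim n)
      show ?case
      proof
        fix x assume x: "x \<in> K"
        have "norm (\<phi> n x) \<le> norm (\<phi>' x) + norm (\<phi> n x - \<phi>' x)"
          by (rule norm_triangle_sub)
        then show "\<phi> n x \<in> cball 0 (R + 1)"
          using R[OF x] bspec[OF elim x] by (simp add: dist_norm)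
      qed
    qed
    show ?thesis
      by (rule uniform_limit_compose_uniformly_continuous_on[OF lim[OF K] _ ev])
        (auto intro!: compact_uniformly_continuous continuous_on_subset[OF c[OF \<omega>]])
  qed
  show ?thesis
  proof (rule integral_dominated_convergence[where w = "\<lambda>_. B"])
    show "(\<lambda>\<omega>. F (\<lambda>x. W (\<phi>' x) \<omega>)) \<in> borel_measurable M"
      by (rule functional_measurable[OF F W cc[OF _ \<phi>(2)]])
    show "(\<lambda>\<omega>. F (\<lambda>x. W (\<phi> n x) \<omega>)) \<in> borel_measurable M" for n
      by (rule functional_measurable[OF F W cc[OF _ \<phi>(1)]])
    show "AE \<omega> in M. (\<lambda>n. F (\<lambda>x. W (\<phi> n x) \<omega>)) \<longlonglongrightarrow> F (\<lambda>x. W (\<phi>' x) \<omega>)"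
      by (intro AE_I2 bounded_continuous_functionalD(2)[OF F] cc \<phi> u)
    show "AE \<omega> in M. norm (F (\<lambda>x. W (\<phi> n x) \<omega>)) \<le> B" for n
      using B cc[OF _ \<phi>(1)] by (intro AE_I2) simp
  qed simp
qed

subsection \<open>Continuous versions of Gaussian fields\<close>

text \<open>Consecutive interpolations eventually differ by at most \<open>B * r ^ n\<close> on a
  given ball, so the telescoping series converges uniformly there by the Weierstrass test.\<close>

lemma interp_limit_continuous:
  fixes g :: "real^2 \<Rightarrow> real"
  assumes r: "0 < r" "r < 1"
    and g: "\<And>n s t. s \<in> dyadic_grid n \<Longrightarrow> t \<in> dyadic_grid (Suc n) \<Longrightarrow> dist s t < 4 / 2 ^ n \<Longrightarrow>
      \<bar>g s - g t\<bar> \<le> B * r ^ n"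
  shows "convergent (\<lambda>n. interp n g x)" and "continuous_on UNIV (\<lambda>x. lim (\<lambda>n. interp n g x))"
proof -
  define d where "d n x = interp (Suc n) g x - interp n g x" for n x
  have u: "uniform_limit (cball 0 R) (\<lambda>n x. interp n g x) (\<lambda>x. interp 0 g x + (\<Sum>i. d i x)) sequentially" for R
  proof -
    have "uniform_limit (cball 0 R) (\<lambda>n x. \<Sum>i<n. d i x) (\<lambda>x. \<Sum>i. d i x) sequentially"
    proof (rule Weierstrass_m_test_ev)
      show "summable (\<lambda>n. B * r ^ n)"
        using r by (intro summable_mult summable_geometric) auto
      \<comment> \<open>The bound starts once \<open>2 ^ n\<close> reaches \<open>R\<close>, because
        \<open>interp_step\<close> speaks of points of norm at most \<open>2 ^ n\<close>.\<close>
      show "\<forall>\<^sub>F n in sequentially. \<forall>x\<in>cball 0 R. norm (d n x) \<le> B * r ^ n"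
        using two_power_ge_norm[of R]
      proof eventually_elim
        case (elim n)
        then show ?case
          unfolding d_def real_norm_def using g by (intro ballI interp_step) auto
      qed
    qed
    then have "uniform_limit (cball 0 R) (\<lambda>n x. interp 0 g x + (\<Sum>i<n. d i x))
        (\<lambda>x. interp 0 g x + (\<Sum>i. d i x)) sequentially"
      by (intro uniform_limit_intros)
    moreover have "interp 0 g x + (\<Sum>i<n. d i x) = interp n g x" for n x
      unfolding d_def by (subst sum_lessThan_telescope) simp
    ultimately show ?thesis by simp
  qed
  have lim: "(\<lambda>n. interp n g x) \<longlonglongrightarrow> interp 0 g x + (\<Sum>i. d i x)" for x
    by (rule tendsto_uniform_limitI[OF u[of "norm x"]]) simp
  then show "convergent (\<lambda>n. interp n g x)" by (auto simp: convergent_def)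
  have "(\<lambda>x. lim (\<lambda>n. interp n g x)) = (\<lambda>x. interp 0 g x + (\<Sum>i. d i x))"
    using limI[OF lim] by auto
  moreover have "isCont (\<lambda>x. interp 0 g x + (\<Sum>i. d i x)) x" for x
  proof (rule continuous_on_interior[of "cball 0 (norm x + 1)"])
    show "continuous_on (cball 0 (norm x + 1)) (\<lambda>x. interp 0 g x + (\<Sum>i. d i x))"
      by (rule uniform_limit_theorem[OF _ u])
        (auto intro!: always_eventually continuous_on_subset[OF continuous_on_interp])
  qed simp
  ultimately show "continuous_on UNIV (\<lambda>x. lim (\<lambda>n. interp n g x))"
    by (simp add: continuous_on_eq_continuous_at)
qed

section \<open>Kolmogorov's criterion through sums of normalised increments\<close>

text \<open>Values in \<open>ennreal\<close> make sense before the series is known to converge. The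
  pairs \<open>P n\<close> stay open since two kinds occur: neighbours in consecutive grids, and
  grid points near a fixed point.\<close>

definition increment_sum ::
  "(real^2 \<Rightarrow> 'w \<Rightarrow> real) \<Rightarrow> real \<Rightarrow> nat \<Rightarrow> (nat \<Rightarrow> ((real^2) \<times> (real^2)) set) \<Rightarrow> 'w \<Rightarrow> ennreal" where
  "increment_sum X r k P \<omega> =
     (\<Sum>n. \<Sum>(s, t)\<in>P n. ennreal (((X s \<omega> - X t \<omega>) / r ^ n) ^ (2 * k)))"

lemma increment_sum_measurable:
  assumes [measurable]: "\<And>x. X x \<in> borel_measurable M"
  shows "increment_sum X r k P \<in> borel_measurable M"
  unfolding increment_sum_def case_prod_beta by measurable

text \<open>Each term of a nonnegative series is at most its sum, so one finite number controls all
  normalised increments.\<close>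

lemma increment_bound_of_sum_finite:
  assumes fin: "increment_sum X r k P \<omega> < \<infinity>" and k: "k > 0" and r: "r > 0"
    and P: "\<And>n. finite (P n)"
  shows "\<exists>B. \<forall>n s t. (s, t) \<in> P n \<longrightarrow> \<bar>X s \<omega> - X t \<omega>\<bar> \<le> B * r ^ n"
proof -
  define S where "S = enn2real (increment_sum X r k P \<omega>)"
  have S: "increment_sum X r k P \<omega> = ennreal S" "S \<ge> 0"
    using fin by (auto simp: S_def)
  have "\<bar>X s \<omega> - X t \<omega>\<bar> \<le> (1 + S) * r ^ n" if "(s, t) \<in> P n" for n s t
  proof -
    have "ennreal (((X s \<omega> - X t \<omega>) / r ^ n) ^ (2 * k)) \<le>
        (\<Sum>(s, t)\<in>P n. ennreal (((X s \<omega> - X t \<omega>) / r ^ n) ^ (2 * k)))"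
      using member_le_sum[OF that, of "\<lambda>(s, t). ennreal (((X s \<omega> - X t \<omega>) / r ^ n) ^ (2 * k))"] P by simp
    also have "\<dots> \<le> increment_sum X r k P \<omega>"
      unfolding increment_sum_def
      using sum_le_suminf[OF summableI, of "{n}" "\<lambda>n. \<Sum>(s, t)\<in>P n. ennreal (((X s \<omega> - X t \<omega>) / r ^ n) ^ (2 * k))"]
      by simp
    finally have "((X s \<omega> - X t \<omega>) / r ^ n) ^ (2 * k) \<le> S"
      unfolding S(1) using S(2) by (simp add: ennreal_le_iff)
    \<comment> \<open>Passing to \<open>(1 + S) ^ (2 * k)\<close> puts the same power on both sides,
      so no root has to be extracted.\<close>
    also have "S \<le> (1 + S) ^ 1" by simp
    also have "\<dots> \<le> (1 + S) ^ (2 * k)"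
      using S(2) k by (intro power_increasing) auto
    finally have "\<bar>(X s \<omega> - X t \<omega>) / r ^ n\<bar> ^ (2 * k) \<le> (1 + S) ^ (2 * k)"
      by (simp add: power_even_abs del: abs_divide)
    then have "\<bar>(X s \<omega> - X t \<omega>) / r ^ n\<bar> \<le> 1 + S"
      using S(2) k by (subst (asm) power_mono_iff) auto
    then show ?thesis
      using r by (simp add: abs_divide divide_simps)
  qed
  then show ?thesis by blast
qed

text \<open>The expectation is finite: level \<open>n\<close> has at most \<open>K * 256 ^ n\<close>
  pairs, each with normalised moment at most \<open>L * (r ^ (2 * k)) ^ n\<close>, and the
  assumption on \<open>k\<close> makes the product at most a multiple of
  \<open>(1 / 2) ^ n\<close>.\<close>

lemma increment_sum_finite:
  assumes M: "prob_space M" and X: "gaussian_field M X" and H: "0 < H" and C: "C \<ge> 0"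
    and var: "\<And>x y. (\<integral>\<omega>. (X x \<omega> - X y \<omega>)\<^sup>2 \<partial>M) \<le> C * norm (x - y) powr (2 * H)"
    and r: "r = 2 powr (- H / 2)" and k: "256 * r ^ (2 * k) \<le> 1 / 2"
    and P: "\<And>n. finite (P n)" "\<And>n. card (P n) \<le> K * 256 ^ n"
    and close: "\<And>n s t. (s, t) \<in> P n \<Longrightarrow> dist s t < 4 / 2 ^ n"
  shows "AE \<omega> in M. increment_sum X r k P \<omega> < \<infinity>"
proof -
  interpret prob_space M by fact
  have r0: "r > 0" by (simp add: r)
  have X_meas [measurable]: "X x \<in> borel_measurable M" for x
    by (rule gaussian_field_measurable[OF X])
  define c where "c = (fact (2 * k) / (2 ^ k * fact k) :: real)"
  define L where "L = c * (C * 4 powr (2 * H)) ^ k"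
  have c0: "c \<ge> 0" by (simp add: c_def)
  then have L0: "L \<ge> 0" using C by (simp add: L_def)
  have moment: "(\<integral>\<^sup>+\<omega>. ennreal (((X s \<omega> - X t \<omega>) / r ^ n) ^ (2 * k)) \<partial>M) \<le> ennreal (L * (r ^ (2 * k)) ^ n)"
    if st: "(s, t) \<in> P n" for n s t
  proof -
    have g: "centered_gaussian_rv M (\<lambda>\<omega>. X s \<omega> - X t \<omega>)"
      by (rule gaussian_field_diff[OF X])
    note em = centered_gaussian_rv_even_moment[OF g M, of k]
    \<comment> \<open>Since \<open>r ^ 4 = 2 powr (-2 * H)\<close>, the variance decays like
      \<open>r ^ (4 * n)\<close>. Dividing increments by \<open>r ^ n\<close> spends half of this
      decay, and the other half is left for summation.\<close>
    have "(4 / 2 ^ n) powr (2 * H) = 4 powr (2 * H) * (r ^ n) ^ 4"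
    proof -
      have "(2 ^ n) powr (2 * H) * (r ^ n) ^ 4 = 1"
        unfolding r by (simp add: powr_realpow[symmetric] powr_powr powr_add[symmetric] field_simps)
      then have "(r ^ n) ^ 4 = 1 / (2 ^ n) powr (2 * H)"
        by (simp add: field_simps)
      then show ?thesis by (simp add: powr_divide)
    qed
    moreover have "norm (s - t) powr (2 * H) \<le> (4 / 2 ^ n) powr (2 * H)"
      using close[OF st] H by (intro powr_mono2) (auto simp: dist_norm)
    ultimately have "C * norm (s - t) powr (2 * H) \<le> C * (4 powr (2 * H) * (r ^ n) ^ 4)"
      using C by (intro mult_left_mono) auto
    with var[of s t] have v: "(\<integral>\<omega>. (X s \<omega> - X t \<omega>)\<^sup>2 \<partial>M) \<le> C * 4 powr (2 * H) * (r ^ n) ^ 4"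
      by (simp add: mult.assoc)
    have "(\<integral>\<omega>. ((X s \<omega> - X t \<omega>) / r ^ n) ^ (2 * k) \<partial>M) =
        c * (\<integral>\<omega>. (X s \<omega> - X t \<omega>)\<^sup>2 \<partial>M) ^ k / (r ^ n) ^ (2 * k)"
      by (simp add: power_divide em(2) c_def)
    also have "\<dots> \<le> c * (C * 4 powr (2 * H) * (r ^ n) ^ 4) ^ k / (r ^ n) ^ (2 * k)"
      using r0 by (intro divide_right_mono mult_left_mono power_mono v c0) auto
    also have "\<dots> = L * (((r ^ n) ^ 4) ^ k / (r ^ n) ^ (2 * k))"
      by (simp add: L_def power_mult_distrib)
    also have "((r ^ n) ^ 4) ^ k / (r ^ n) ^ (2 * k) = (r ^ n) ^ (2 * k)"
    proof -
      have "((r ^ n) ^ 4) ^ k = (r ^ n) ^ (2 * k) * (r ^ n) ^ (2 * k)"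
        by (simp add: power_mult[symmetric] power_add[symmetric] mult_ac)
      then show ?thesis using r0 by simp
    qed
    also have "(r ^ n) ^ (2 * k) = (r ^ (2 * k)) ^ n"
      by (simp add: power_mult[symmetric] mult.commute)
    finally have "(\<integral>\<omega>. ((X s \<omega> - X t \<omega>) / r ^ n) ^ (2 * k) \<partial>M) \<le> L * (r ^ (2 * k)) ^ n" .
    moreover have "integrable M (\<lambda>\<omega>. ((X s \<omega> - X t \<omega>) / r ^ n) ^ (2 * k))"
      using em(1) by (simp add: power_divide)
    ultimately show ?thesis
      by (subst nn_integral_eq_integral) (auto intro!: ennreal_leI)
  qed
  have level_bound: "(\<integral>\<^sup>+\<omega>. (\<Sum>(s, t)\<in>P n. ennreal (((X s \<omega> - X t \<omega>) / r ^ n) ^ (2 * k))) \<partial>M) \<le>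
      ennreal (K * L * (1 / 2) ^ n)" for n
  proof -
    have "(\<integral>\<^sup>+\<omega>. (\<Sum>(s, t)\<in>P n. ennreal (((X s \<omega> - X t \<omega>) / r ^ n) ^ (2 * k))) \<partial>M) =
        (\<Sum>(s, t)\<in>P n. \<integral>\<^sup>+\<omega>. ennreal (((X s \<omega> - X t \<omega>) / r ^ n) ^ (2 * k)) \<partial>M)"
      unfolding case_prod_beta by (intro nn_integral_sum) measurable
    also have "\<dots> \<le> (\<Sum>(s, t)\<in>P n. ennreal (L * (r ^ (2 * k)) ^ n))"
      using moment by (intro sum_mono) auto
    also have "\<dots> = ennreal (card (P n) * (L * (r ^ (2 * k)) ^ n))"
      using L0 r0 by (simp add: case_prod_beta ennreal_mult' ennreal_of_nat_eq_real_of_nat)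
    also have "\<dots> \<le> ennreal (K * L * (1 / 2) ^ n)"
    proof (rule ennreal_leI)
      have "real (card (P n)) \<le> real K * 256 ^ n"
        using P(2)[of n] by (simp flip: of_nat_le_iff[where 'a = real])
      then have "real (card (P n)) * (L * (r ^ (2 * k)) ^ n) \<le> (real K * 256 ^ n) * (L * (r ^ (2 * k)) ^ n)"
        using L0 r0 by (intro mult_right_mono) auto
      also have "\<dots> = real K * L * (256 * r ^ (2 * k)) ^ n"
        by (simp add: power_mult_distrib)
      also have "\<dots> \<le> real K * L * (1 / 2) ^ n"
        using L0 r0 k by (intro mult_left_mono power_mono) auto
      finally show "real (card (P n)) * (L * (r ^ (2 * k)) ^ n) \<le> real K * L * (1 / 2) ^ n" .
    qed
    finally show ?thesis .
  qed
  have "(\<integral>\<^sup>+\<omega>. increment_sum X r k P \<omega> \<partial>M) =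
      (\<Sum>n. \<integral>\<^sup>+\<omega>. (\<Sum>(s, t)\<in>P n. ennreal (((X s \<omega> - X t \<omega>) / r ^ n) ^ (2 * k))) \<partial>M)"
    unfolding increment_sum_def case_prod_beta by (intro nn_integral_suminf) measurable
  also have "\<dots> \<le> (\<Sum>n. ennreal (K * L * (1 / 2) ^ n))"
    by (intro suminf_le level_bound summableI)
  also have "\<dots> = ennreal (\<Sum>n. K * L * (1 / 2) ^ n)"
    using L0 by (intro suminf_ennreal2 summable_mult summable_geometric) auto
  also have "\<dots> < \<infinity>" by simp
  finally show ?thesis
    using nn_integral_PInf_AE[OF increment_sum_measurable[OF X_meas]]
    by (auto simp: less_top)
qed

text \<open>The version is the limit of the interpolations of \<open>X\<close>. Increments between
  consecutive grids give its continuity; increments towards a fixed point show that it agrees there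
  with \<open>X\<close> almost surely.\<close>

lemma gaussian_field_continuous_version:
  assumes M: "prob_space M" and X: "gaussian_field M X" and H: "0 < H" and C: "C \<ge> 0"
    and var: "\<And>x y. (\<integral>\<omega>. (X x \<omega> - X y \<omega>)\<^sup>2 \<partial>M) \<le> C * norm (x - y) powr (2 * H)"
  shows "\<exists>X'. continuous_version M X X'"
proof -
  interpret prob_space M by fact
  have X_meas [measurable]: "X x \<in> borel_measurable M" for x
    by (rule gaussian_field_measurable[OF X])
  define r where "r = 2 powr (- H / 2)"
  have r: "0 < r" "r < 1" using H by (auto simp: r_def powr_less_one)
  \<comment> \<open>The bound \<open>1 / 512\<close> beats the \<open>256 ^ n\<close> pairs with a
    factor \<open>1 / 2\<close> to spare.\<close>
  obtain k where "(r\<^sup>2) ^ k < 1 / 512"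
    using real_arch_pow_inv[of "1 / 512" "r\<^sup>2"] r by (auto simp: power_less_one_iff)
  then have k: "256 * r ^ (2 * k) \<le> 1 / 2"
    by (simp add: power_mult)
  have k0: "k > 0" using k by (cases k) auto
  define P where "P n = {(s, t). s \<in> dyadic_grid n \<and> t \<in> dyadic_grid (Suc n) \<and> dist s t < 4 / 2 ^ n}" for n
  have P_sub: "P n \<subseteq> dyadic_grid n \<times> dyadic_grid (Suc n)" for n by (auto simp: P_def)
  have P_fin: "finite (P n)" for n
    by (rule finite_subset[OF P_sub]) (simp add: finite_dyadic_grid)
  have P_card: "card (P n) \<le> 1296 * 256 ^ n" for n
  proof -
    have "card (P n) \<le> card (dyadic_grid n) * card (dyadic_grid (Suc n))"
      unfolding card_cartesian_product[symmetric]
      by (intro card_mono P_sub) (simp add: finite_dyadic_grid)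
    also have "\<dots> \<le> (9 * 16 ^ n) * (9 * 16 ^ Suc n)"
      by (intro mult_mono card_dyadic_grid) auto
    also have "\<dots> = 1296 * 256 ^ n"
      by (simp add: power_mult_distrib[symmetric])
    finally show ?thesis .
  qed
  define G where "G = {\<omega> \<in> space M. increment_sum X r k P \<omega> < \<infinity>}"
  have G [measurable]: "G \<in> sets M"
    unfolding G_def using increment_sum_measurable[OF X_meas] by measurable
  have AE_G: "AE \<omega> in M. \<omega> \<in> G"
  proof -
    have "AE \<omega> in M. increment_sum X r k P \<omega> < \<infinity>"
      by (rule increment_sum_finite[OF M X H C var r_def k P_fin P_card]) (simp add: P_def)
    then show ?thesis by (rule AE_mp) (auto simp: G_def)
  qed
  have path: "convergent (\<lambda>n. interp n (\<lambda>x. X x \<omega>) x)"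
    "continuous_on UNIV (\<lambda>x. lim (\<lambda>n. interp n (\<lambda>x. X x \<omega>) x))" if "\<omega> \<in> G" for \<omega> x
  proof -
    have fin: "increment_sum X r k P \<omega> < \<infinity>"
      using that by (simp add: G_def)
    obtain B where "\<And>n s t. (s, t) \<in> P n \<Longrightarrow> \<bar>X s \<omega> - X t \<omega>\<bar> \<le> B * r ^ n"
      using increment_bound_of_sum_finite[OF fin k0 r(1) P_fin] by blast
    then have B: "\<And>n s t. s \<in> dyadic_grid n \<Longrightarrow> t \<in> dyadic_grid (Suc n) \<Longrightarrow> dist s t < 4 / 2 ^ n \<Longrightarrow>
      \<bar>X s \<omega> - X t \<omega>\<bar> \<le> B * r ^ n"
      by (simp add: P_def)
    show "convergent (\<lambda>n. interp n (\<lambda>x. X x \<omega>) x)"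
      by (rule interp_limit_continuous(1)[OF r B])
    show "continuous_on UNIV (\<lambda>x. lim (\<lambda>n. interp n (\<lambda>x. X x \<omega>) x))"
      by (rule interp_limit_continuous(2)[OF r B])
  qed
  \<comment> \<open>The value \<open>0\<close> off the almost sure event \<open>G\<close> keeps
    every path continuous, as \<open>continuous_version\<close> asks.\<close>
  define X' where "X' x \<omega> = (if \<omega> \<in> G then lim (\<lambda>n. interp n (\<lambda>x. X x \<omega>) x) else 0)" for x \<omega>
  have interp_meas [measurable]: "(\<lambda>\<omega>. interp n (\<lambda>x. X x \<omega>) x) \<in> borel_measurable M" for n x
    unfolding interp_def by measurable
  have X'_meas: "X' x \<in> borel_measurable M" for x
    unfolding X'_def by (intro measurable_If_set borel_measurable_lim_metric) auto
  have "AE \<omega> in M. X' x \<omega> = X x \<omega>" for x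
  proof -
    \<comment> \<open>The moment sum is used again, now for pairs of a nearby grid point and
      \<open>x\<close> itself, to identify the limit at \<open>x\<close>.\<close>
    define Q where "Q n = {(s, t). s \<in> dyadic_grid n \<and> t = x \<and> dist s t < 2 / 2 ^ n}" for n
    have Q_sub: "Q n \<subseteq> dyadic_grid n \<times> {x}" for n by (auto simp: Q_def)
    have Q_fin: "finite (Q n)" for n
      by (rule finite_subset[OF Q_sub]) (simp add: finite_dyadic_grid)
    have Q_card: "card (Q n) \<le> 9 * 256 ^ n" for n
    proof -
      have "card (Q n) \<le> card (dyadic_grid n) * card {x}"
        unfolding card_cartesian_product[symmetric]
        by (intro card_mono Q_sub) (simp add: finite_dyadic_grid)
      also have "\<dots> \<le> (9 * 16 ^ n) * 1"
        by (intro mult_mono card_dyadic_grid) auto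
      also have "\<dots> \<le> 9 * 256 ^ n"
        by (simp add: power_mono)
      finally show ?thesis .
    qed
    have "AE \<omega> in M. increment_sum X r k Q \<omega> < \<infinity>"
    proof (rule increment_sum_finite[OF M X H C var r_def k Q_fin Q_card])
      fix n s t assume "(s, t) \<in> Q n"
      then have "dist s t < 2 / 2 ^ n" by (auto simp: Q_def)
      also have "\<dots> \<le> 4 / 2 ^ n" by (intro divide_right_mono) auto
      finally show "dist s t < 4 / 2 ^ n" .
    qed
    with AE_G show ?thesis
    proof eventually_elim
      case (elim \<omega>)
      obtain B where B: "\<And>n s t. (s, t) \<in> Q n \<Longrightarrow> \<bar>X s \<omega> - X t \<omega>\<bar> \<le> B * r ^ n"
        using increment_bound_of_sum_finite[OF elim(2) k0 r(1) Q_fin] by blast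
      have "(\<lambda>n. interp n (\<lambda>x. X x \<omega>) x - X x \<omega>) \<longlonglongrightarrow> 0"
      proof (rule Lim_null_comparison)
        show "\<forall>\<^sub>F n in sequentially. norm (interp n (\<lambda>x. X x \<omega>) x - X x \<omega>) \<le> B * r ^ n"
          using two_power_ge_norm[of "norm x"]
        proof eventually_elim
          case (elim n)
          then show ?case
            unfolding real_norm_def
            by (intro interp_close B) (auto simp: Q_def dist_commute)
        qed
        have "(\<lambda>n. B * r ^ n) \<longlonglongrightarrow> B * 0"
          using r by (intro tendsto_intros LIMSEQ_realpow_zero) auto
        then show "(\<lambda>n. B * r ^ n) \<longlonglongrightarrow> 0" by simp
      qed
      then have "(\<lambda>n. interp n (\<lambda>x. X x \<omega>) x) \<longlonglongrightarrow> X x \<omega>"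
        by (rule LIM_zero_cancel)
      then show ?case
        using elim(1) by (simp add: X'_def limI)
    qed
  qed
  moreover have "continuous_on UNIV (\<lambda>x. X' x \<omega>)" for \<omega>
    using path(2)[of \<omega>] by (cases "\<omega> \<in> G") (simp_all add: X'_def)
  ultimately show ?thesis
    unfolding continuous_version_def using X'_meas by blast
qed

subsection \<open>Self-similar fields with stationary increments\<close>

lemma self_similar_gaussian_fieldD:
  assumes "self_similar_gaussian_field H M X C"
  shows "prob_space M" "gaussian_field M X" "self_similar H M X" "stationary_increments M X"
    "has_spectral_density M X (\<lambda>\<xi>. norm \<xi> powr (-2 * H - 2) * C (\<xi> /\<^sub>R norm \<xi>))"
    "X x \<in> borel_measurable M"
  using assms gaussian_field_measurable unfolding self_similar_gaussian_field_def by blast+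

lemma gaussian_field_square_integrable:
  assumes "prob_space M" "gaussian_field M X"
  shows "integrable M (\<lambda>\<omega>. (X x \<omega>)\<^sup>2)" "integrable M (\<lambda>\<omega>. (X x \<omega> - X y \<omega>)\<^sup>2)"
  using centered_gaussian_rv_even_moment(1)[OF gaussian_field_single assms(1), of X x 1]
    centered_gaussian_rv_even_moment(1)[OF gaussian_field_diff assms(1), of X x y 1] assms(2) by simp_all

lemma has_spectral_density_cong:
  assumes "has_spectral_density M Y f"
    and "\<And>x y. (\<integral>\<omega>. Y' x \<omega> * Y' y \<omega> \<partial>M') = (\<integral>\<omega>. Y x \<omega> * Y y \<omega> \<partial>M)"
  shows "has_spectral_density M' Y' f"
  using assms(1) unfolding has_spectral_density_def assms(2) .

context
  fixes H :: real and M :: "'w measure" and X :: "real^2 \<Rightarrow> 'w \<Rightarrow> real" and C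
  assumes X: "self_similar_gaussian_field H M X C"
begin

private lemma X_meas [measurable]: "X x \<in> borel_measurable M"
  by (rule self_similar_gaussian_fieldD[OF X])

text \<open>The spectral kernel vanishes when both arguments are \<open>0\<close>, so
  \<open>X 0\<close> has second moment zero.\<close>

lemma self_similar_gaussian_field_zero: "AE \<omega> in M. X 0 \<omega> = 0"
proof -
  have "of_real (\<integral>\<omega>. X 0 \<omega> * X 0 \<omega> \<partial>M) =
      (\<integral>\<xi>. spectral_kernel 0 0 \<xi> * of_real (norm \<xi> powr (-2 * H - 2) * C (\<xi> /\<^sub>R norm \<xi>)) \<partial>lborel)"
    using self_similar_gaussian_fieldD(5)[OF X] unfolding has_spectral_density_def by blast
  also have "\<dots> = 0" by (simp add: spectral_kernel_def)
  finally have "(\<integral>\<omega>. (X 0 \<omega>)\<^sup>2 \<partial>M) = 0" by (simp add: power2_eq_square)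
  moreover have "integrable M (\<lambda>\<omega>. (X 0 \<omega>)\<^sup>2)"
    using gaussian_field_square_integrable self_similar_gaussian_fieldD[OF X] by blast
  ultimately have "AE \<omega> in M. (X 0 \<omega>)\<^sup>2 = 0"
    by (subst (asm) integral_nonneg_eq_0_iff_AE) auto
  then show ?thesis by simp
qed

lemma self_similar_covariance:
  assumes c: "c > 0"
  shows "(\<integral>\<omega>. X (c *\<^sub>R x) \<omega> * X (c *\<^sub>R y) \<omega> \<partial>M) = c powr (2 * H) * (\<integral>\<omega>. X x \<omega> * X y \<omega> \<partial>M)"
proof -
  have fdd: "same_fdd M (\<lambda>x. X (c *\<^sub>R x)) (\<lambda>x \<omega>. c powr H * X x \<omega>)"
    using self_similar_gaussian_fieldD(3)[OF X] c unfolding self_similar_def by blast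
  have f: "(\<lambda>g. g x * g y :: real) \<in> borel_measurable (Pi\<^sub>M {x, y} (\<lambda>_. borel))"
    by (intro borel_measurable_times measurable_component_singleton) auto
  have "(\<integral>\<omega>. X (c *\<^sub>R x) \<omega> * X (c *\<^sub>R y) \<omega> \<partial>M) =
      (\<integral>\<omega>. (c powr H * X x \<omega>) * (c powr H * X y \<omega>) \<partial>M)"
    using same_fdd_integral[OF _ _ fdd _ f] by simp
  also have "\<dots> = (\<integral>\<omega>. c powr (2 * H) * (X x \<omega> * X y \<omega>) \<partial>M)"
    by (intro Bochner_Integration.integral_cong refl) (simp add: powr_add[symmetric] mult_ac)
  finally show ?thesis by simp
qed

lemma stationary_increments_variance:
  "(\<integral>\<omega>. (X x \<omega> - X y \<omega>)\<^sup>2 \<partial>M) = (\<integral>\<omega>. (X (x - y) \<omega>)\<^sup>2 \<partial>M)"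
proof -
  have fdd: "same_fdd M (\<lambda>x \<omega>. X (x + y) \<omega> - X y \<omega>) (\<lambda>x \<omega>. X x \<omega> - X 0 \<omega>)"
    using self_similar_gaussian_fieldD(4)[OF X] unfolding stationary_increments_def by blast
  have "(\<integral>\<omega>. (X x \<omega> - X y \<omega>)\<^sup>2 \<partial>M) = (\<integral>\<omega>. (X (x - y) \<omega> - X 0 \<omega>)\<^sup>2 \<partial>M)"
    using same_fdd_integral_single[OF _ _ fdd, of "\<lambda>v. v\<^sup>2" "x - y"] by simp
  also have "\<dots> = (\<integral>\<omega>. (X (x - y) \<omega>)\<^sup>2 \<partial>M)"
    using self_similar_gaussian_field_zero by (intro integral_cong_AE) auto
  finally show ?thesis .
qed

text \<open>Self-similarity controls the variance along rays only, so \<open>x\<close> is split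
  along the two axes and the parts are recombined by a quadratic inequality. The four axis
  directions supply the constant.\<close>

lemma self_similar_variance_bound:
  assumes H: "0 < H"
  shows "\<exists>K\<ge>0. \<forall>x y. (\<integral>\<omega>. (X x \<omega> - X y \<omega>)\<^sup>2 \<partial>M) \<le> K * norm (x - y) powr (2 * H)"
proof -
  define v where "v x = (\<integral>\<omega>. (X x \<omega>)\<^sup>2 \<partial>M)" for x
  have v0: "v x \<ge> 0" for x by (simp add: v_def)
  note int = gaussian_field_square_integrable[OF self_similar_gaussian_fieldD(1,2)[OF X]]
  have add: "v (a + b) \<le> 2 * v a + 2 * v b" for a b
  proof -
    have "v (a + b) \<le> (\<integral>\<omega>. 2 * (X (a + b) \<omega> - X b \<omega>)\<^sup>2 + 2 * (X b \<omega>)\<^sup>2 \<partial>M)"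
      unfolding v_def
    proof (intro integral_mono int Bochner_Integration.integrable_add integrable_mult_right)
      fix \<omega>
      \<comment> \<open>This square is exactly the difference of the two sides below.\<close>
      have "0 \<le> (X (a + b) \<omega> - 2 * X b \<omega>)\<^sup>2" by simp
      then show "(X (a + b) \<omega>)\<^sup>2 \<le> 2 * (X (a + b) \<omega> - X b \<omega>)\<^sup>2 + 2 * (X b \<omega>)\<^sup>2"
        by (simp add: power2_eq_square algebra_simps)
    qed
    also have "\<dots> = 2 * v a + 2 * v b"
      using int stationary_increments_variance[of "a + b" b] by (simp add: v_def)
    finally show ?thesis .
  qed
  have scale: "v (c *\<^sub>R x) = c powr (2 * H) * v x" if "c > 0" for c x
    using self_similar_covariance[OF that, of x x] by (simp add: v_def power2_eq_square)
  have zero: "v 0 = 0"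
    unfolding v_def using self_similar_gaussian_field_zero by (intro integral_eq_zero_AE) auto
  \<comment> \<open>Scaling applies to positive factors, so \<open>- x\<close> counts as a second
    ray, and adding both variances covers either sign of \<open>c\<close>.\<close>
  have line: "v (c *\<^sub>R x) \<le> \<bar>c\<bar> powr (2 * H) * (v x + v (- x))" for c x
  proof -
    consider "c > 0" | "c = 0" | "c < 0" by linarith
    then show ?thesis
    proof cases
      case 3
      then show ?thesis
        using scale[of "- c" "- x"] v0[of x] by (simp add: mult_left_mono)
    qed (use scale[of c x] v0[of "-x"] zero in \<open>simp_all add: mult_left_mono\<close>)
  qed
  define K where "K = 2 * (v (axis 1 1) + v (- axis 1 1)) + 2 * (v (axis 2 1) + v (- axis 2 1))"
  have "v x \<le> K * norm x powr (2 * H)" for x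
  proof -
    have "x = x $ 1 *\<^sub>R axis 1 1 + x $ 2 *\<^sub>R axis 2 1"
      by (simp add: vec_eq_iff forall_2 axis_def)
    then have "v x \<le> 2 * v (x $ 1 *\<^sub>R axis 1 1) + 2 * v (x $ 2 *\<^sub>R axis 2 1)"
      using add by metis
    moreover have comp: "v (x $ i *\<^sub>R axis i 1) \<le> norm x powr (2 * H) * (v (axis i 1) + v (- axis i 1))" for i
    proof -
      have "\<bar>x $ i\<bar> powr (2 * H) \<le> norm x powr (2 * H)"
        using component_le_norm_cart[of x i] H by (intro powr_mono2) auto
      then have "\<bar>x $ i\<bar> powr (2 * H) * (v (axis i 1) + v (- axis i 1)) \<le>
          norm x powr (2 * H) * (v (axis i 1) + v (- axis i 1))"
        using v0 by (intro mult_right_mono) auto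
      with line[of "x $ i" "axis i 1"] show ?thesis by linarith
    qed
    ultimately have "v x \<le> 2 * (norm x powr (2 * H) * (v (axis 1 1) + v (- axis 1 1))) +
        2 * (norm x powr (2 * H) * (v (axis 2 1) + v (- axis 2 1)))"
      using comp[of 1] comp[of 2] by linarith
    then show ?thesis
      unfolding K_def by (simp add: algebra_simps)
  qed
  moreover have "K \<ge> 0" unfolding K_def using v0 by simp
  ultimately show ?thesis
    unfolding stationary_increments_variance v_def by blast
qed

lemma self_similar_gaussian_field_continuous_version:
  assumes "0 < H"
  shows "\<exists>X'. continuous_version M X X'"
  using self_similar_variance_bound[OF assms]
    gaussian_field_continuous_version[OF self_similar_gaussian_fieldD(1,2)[OF X] assms] by blast

end

section \<open>Rotated and rescaled fields\<close>

text \<open>The preimage of a box is its image under the inverse, again orthogonal and so measure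
  preserving; agreement on boxes identifies the measure.\<close>

lemma lborel_distr_orthogonal:
  fixes f :: "real^'n::{finite,wellorder} \<Rightarrow> real^'n::_"
  assumes f: "orthogonal_transformation f"
  shows "distr lborel borel f = lborel"
proof (rule lborel_eqI[symmetric])
  have lin: "linear f" by (rule orthogonal_transformation_linear[OF f])
  have meas [measurable]: "f \<in> borel_measurable borel"
    by (intro borel_measurable_continuous_onI linear_continuous_on linear_conv_bounded_linear[THEN iffD1] lin)
  fix l u :: "real^'n::_" assume le: "\<And>b. b \<in> Basis \<Longrightarrow> l \<bullet> b \<le> u \<bullet> b"
  have g: "orthogonal_transformation (inv f)"
    by (rule orthogonal_transformation_inv[OF f])
  have "f -` box l u = inv f ` box l u"
    using orthogonal_transformation_bij[OF f] by (rule bij_vimage_eq_inv_image)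
  then have "measure lebesgue (f -` box l u) = measure lebesgue (box l u)" and
    fin: "f -` box l u \<in> lmeasurable"
    using measure_orthogonal_image[OF g, of "box l u"] measurable_orthogonal_image[OF g, of "box l u"] by simp_all
  moreover have "emeasure lborel (f -` box l u) = emeasure lebesgue (f -` box l u)"
    using measurable_sets_borel[OF meas, of "box l u"] by simp
  ultimately have "emeasure (distr lborel borel f) (box l u) = measure lborel (box l u)"
    by (simp add: emeasure_distr emeasure_eq_measure2 fmeasurableD2 fmeasurableD)
  then show "emeasure (distr lborel borel f) (box l u) = (\<Prod>b\<in>Basis. (u - l) \<bullet> b)"
    using le by simp
qed simp

text \<open>Substituting \<open>R \<xi>\<close> in the spectral integral preserves Lebesgue measure,
  and the kernel is unchanged when its two points are rotated as well. The dilation contributes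
  \<open>c powr (2 * H)\<close> by self-similarity.\<close>

lemma has_spectral_density_rotate:
  fixes R :: "real^2 \<Rightarrow> real^2"
  assumes R: "orthogonal_transformation R" and c: "c > 0"
    and X: "self_similar_gaussian_field H M X C"
  shows "has_spectral_density M (\<lambda>x. X (c *\<^sub>R R x))
    (\<lambda>\<xi>. norm \<xi> powr (-2 * H - 2) * (c powr (2 * H) * C (R (\<xi> /\<^sub>R norm \<xi>))))"
proof -
  define f where "f \<xi> = norm \<xi> powr (-2 * H - 2) * C (\<xi> /\<^sub>R norm \<xi>)" for \<xi>
  have sd: "has_spectral_density M X f"
    using self_similar_gaussian_fieldD(5)[OF X] by (simp add: f_def[abs_def])
  then have f [measurable]: "f \<in> borel_measurable borel" and f0: "\<And>\<xi>. f \<xi> \<ge> 0"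
    and int: "\<And>x y. integrable lborel (\<lambda>\<xi>. spectral_kernel x y \<xi> * of_real (f \<xi>))"
    and cov: "\<And>x y. of_real (\<integral>\<omega>. X x \<omega> * X y \<omega> \<partial>M) =
       (\<integral>\<xi>. spectral_kernel x y \<xi> * of_real (f \<xi>) \<partial>lborel)"
    unfolding has_spectral_density_def by blast+
  have lin: "linear R" by (rule orthogonal_transformation_linear[OF R])
  have R_meas [measurable]: "R \<in> borel_measurable borel"
    by (intro borel_measurable_continuous_onI linear_continuous_on linear_conv_bounded_linear[THEN iffD1] lin)
  have k: "spectral_kernel (R x) (R y) (R \<xi>) = spectral_kernel x y \<xi>" for x y \<xi>
    using R by (simp add: spectral_kernel_def orthogonal_transformation_def)
  have fR: "norm \<xi> powr (-2 * H - 2) * (c powr (2 * H) * C (R (\<xi> /\<^sub>R norm \<xi>))) = c powr (2 * H) * f (R \<xi>)" for \<xi>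
    by (simp add: f_def orthogonal_transformation_norm[OF R] linear_cmul[OF lin])
  have k_meas [measurable]: "(\<lambda>\<xi>. spectral_kernel x y \<xi> * of_real (f \<xi>)) \<in> borel_measurable borel" for x y
    using int[of x y] by (auto dest: borel_measurable_integrable)
  have int': "integrable lborel (\<lambda>\<xi>. spectral_kernel x y \<xi> * of_real (f (R \<xi>)))" for x y
    using int[of "R x" "R y"]
    by (subst (asm) lborel_distr_orthogonal[OF R, symmetric], subst (asm) integrable_distr_eq) (simp_all add: k)
  have cov': "(\<integral>\<xi>. spectral_kernel x y \<xi> * of_real (f (R \<xi>)) \<partial>lborel) =
      of_real (\<integral>\<omega>. X (R x) \<omega> * X (R y) \<omega> \<partial>M)" for x y
    unfolding cov
    by (subst (2) lborel_distr_orthogonal[OF R, symmetric], subst integral_distr) (simp_all add: k)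
  have e: "spectral_kernel x y \<xi> * of_real (c powr (2 * H) * f (R \<xi>)) =
      of_real (c powr (2 * H)) * (spectral_kernel x y \<xi> * of_real (f (R \<xi>)))" for x y \<xi>
    by simp
  show ?thesis
    unfolding has_spectral_density_def fR e
    using f0 int' by (simp add: cov' self_similar_covariance[OF X c] powr_ge_zero)
qed

text \<open>A linear map commutes with dilations and turns the shift by \<open>h\<close> into the
  shift by its image, so self-similarity and stationarity are inherited.\<close>

lemma self_similar_gaussian_field_rotate:
  fixes R :: "real^2 \<Rightarrow> real^2"
  assumes R: "orthogonal_transformation R" and c: "c > 0"
    and X: "self_similar_gaussian_field H M X C"
  shows "self_similar_gaussian_field H M (\<lambda>x. X (c *\<^sub>R R x)) (\<lambda>\<Theta>. c powr (2 * H) * C (R \<Theta>))"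
proof -
  note [measurable] = self_similar_gaussian_fieldD(6)[OF X]
  have lin: "linear R" by (rule orthogonal_transformation_linear[OF R])
  have "self_similar H M (\<lambda>x. X (c *\<^sub>R R x))"
    unfolding self_similar_def
  proof (intro allI impI)
    fix \<rho> :: real assume "\<rho> > 0"
    then have "same_fdd M (\<lambda>x. X (\<rho> *\<^sub>R x)) (\<lambda>x \<omega>. \<rho> powr H * X x \<omega>)"
      using self_similar_gaussian_fieldD(3)[OF X] unfolding self_similar_def by blast
    from same_fdd_transform[OF _ _ this, of 1 "\<lambda>x. c *\<^sub>R R x"]
    show "same_fdd M (\<lambda>x. X (c *\<^sub>R R (\<rho> *\<^sub>R x))) (\<lambda>x \<omega>. \<rho> powr H * X (c *\<^sub>R R x) \<omega>)"
      by (simp add: linear_cmul[OF lin] mult.commute)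
  qed
  moreover have "stationary_increments M (\<lambda>x. X (c *\<^sub>R R x))"
    unfolding stationary_increments_def
  proof
    fix h
    have "same_fdd M (\<lambda>x \<omega>. X (x + c *\<^sub>R R h) \<omega> - X (c *\<^sub>R R h) \<omega>) (\<lambda>x \<omega>. X x \<omega> - X 0 \<omega>)"
      using self_similar_gaussian_fieldD(4)[OF X] unfolding stationary_increments_def by blast
    from same_fdd_transform[OF _ _ this, of 1 "\<lambda>x. c *\<^sub>R R x"]
    show "same_fdd M (\<lambda>x \<omega>. X (c *\<^sub>R R (x + h)) \<omega> - X (c *\<^sub>R R h) \<omega>)
        (\<lambda>x \<omega>. X (c *\<^sub>R R x) \<omega> - X (c *\<^sub>R R 0) \<omega>)"
      by (simp add: linear_add[OF lin] linear_0[OF lin] scaleR_add_right)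
  qed
  ultimately show ?thesis
    unfolding self_similar_gaussian_field_def
    using self_similar_gaussian_fieldD(1,2)[OF X] has_spectral_density_rotate[OF R c X]
      gaussian_field_compose by blast
qed

section \<open>Invariance under versions and image measures\<close>

text \<open>Every clause about the field concerns finitely many points at a time, hence finitely
  many null sets.\<close>

lemma self_similar_gaussian_field_version:
  assumes X: "self_similar_gaussian_field H M X C"
    and X': "\<And>x. X' x \<in> borel_measurable M" and ae: "\<And>x. AE \<omega> in M. X' x \<omega> = X x \<omega>"
  shows "self_similar_gaussian_field H M X' C"
proof -
  note [measurable] = self_similar_gaussian_fieldD(6)[OF X] X'
  have ae_diff: "AE \<omega> in M. X' x \<omega> - X' y \<omega> = X x \<omega> - X y \<omega>" for x y
    using ae[of x] ae[of y] by eventually_elim simp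
  have "gaussian_field M X'"
    unfolding gaussian_field_def
  proof (intro allI impI)
    fix S :: "(real^2) set" and a assume S: "finite S"
    have "AE \<omega> in M. \<forall>x\<in>S. X' x \<omega> = X x \<omega>"
      using ae S by (simp add: AE_finite_all)
    then have "AE \<omega> in M. (\<Sum>x\<in>S. a x * X x \<omega>) = (\<Sum>x\<in>S. a x * X' x \<omega>)"
      by eventually_elim simp
    then show "centered_gaussian_rv M (\<lambda>\<omega>. \<Sum>x\<in>S. a x * X' x \<omega>)"
      by (rule centered_gaussian_rv_cong_AE[OF gaussian_fieldD[OF self_similar_gaussian_fieldD(2)[OF X] S], rotated])
        measurable
  qed
  moreover have "self_similar H M X'"
    unfolding self_similar_def
  proof (intro allI impI)
    fix \<rho> :: real assume "\<rho> > 0"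
    then have "same_fdd M (\<lambda>x. X (\<rho> *\<^sub>R x)) (\<lambda>x \<omega>. \<rho> powr H * X x \<omega>)"
      using self_similar_gaussian_fieldD(3)[OF X] unfolding self_similar_def by blast
    moreover have "same_fdd M (\<lambda>x. X' (\<rho> *\<^sub>R x)) (\<lambda>x. X (\<rho> *\<^sub>R x))"
      using ae by (intro same_fdd_AE) measurable
    moreover have "AE \<omega> in M. \<rho> powr H * X x \<omega> = \<rho> powr H * X' x \<omega>" for x
      using ae[of x] by eventually_elim simp
    then have "same_fdd M (\<lambda>x \<omega>. \<rho> powr H * X x \<omega>) (\<lambda>x \<omega>. \<rho> powr H * X' x \<omega>)"
      by (intro same_fdd_AE) measurable
    ultimately show "same_fdd M (\<lambda>x. X' (\<rho> *\<^sub>R x)) (\<lambda>x \<omega>. \<rho> powr H * X' x \<omega>)"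
      by (blast intro: same_fdd_trans)
  qed
  moreover have "stationary_increments M X'"
    unfolding stationary_increments_def
  proof
    fix h
    have "same_fdd M (\<lambda>x \<omega>. X (x + h) \<omega> - X h \<omega>) (\<lambda>x \<omega>. X x \<omega> - X 0 \<omega>)"
      using self_similar_gaussian_fieldD(4)[OF X] unfolding stationary_increments_def by blast
    moreover have "same_fdd M (\<lambda>x \<omega>. X' (x + h) \<omega> - X' h \<omega>) (\<lambda>x \<omega>. X (x + h) \<omega> - X h \<omega>)"
      using ae_diff by (intro same_fdd_AE) measurable
    moreover have "same_fdd M (\<lambda>x \<omega>. X' x \<omega> - X' 0 \<omega>) (\<lambda>x \<omega>. X x \<omega> - X 0 \<omega>)"
      using ae_diff by (intro same_fdd_AE) measurable
    ultimately show "same_fdd M (\<lambda>x \<omega>. X' (x + h) \<omega> - X' h \<omega>) (\<lambda>x \<omega>. X' x \<omega> - X' 0 \<omega>)"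
      by (blast intro: same_fdd_trans same_fdd_sym)
  qed
  moreover have cov: "(\<integral>\<omega>. X' x \<omega> * X' y \<omega> \<partial>M) = (\<integral>\<omega>. X x \<omega> * X y \<omega> \<partial>M)" for x y
  proof (rule integral_cong_AE)
    show "AE \<omega> in M. X' x \<omega> * X' y \<omega> = X x \<omega> * X y \<omega>"
      using ae[of x] ae[of y] by eventually_elim simp
  qed measurable
  ultimately show ?thesis
    unfolding self_similar_gaussian_field_def
    using self_similar_gaussian_fieldD(1)[OF X]
      has_spectral_density_cong[OF self_similar_gaussian_fieldD(5)[OF X] cov] by blast
qed

text \<open>This allows a field built on \<open>M\<close> to be replaced by the coordinate field on
  path space.\<close>

lemma self_similar_gaussian_field_distr:
  assumes T: "T \<in> measurable M N" and Y: "\<And>x. Y x \<in> borel_measurable N"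
    and X: "self_similar_gaussian_field H M (\<lambda>x \<omega>. Y x (T \<omega>)) C"
  shows "self_similar_gaussian_field H (distr M N T) Y C"
proof -
  note [measurable] = T Y
  have "prob_space (distr M N T)"
    by (intro prob_space.prob_space_distr self_similar_gaussian_fieldD(1)[OF X] T)
  moreover have "gaussian_field (distr M N T) Y"
    unfolding gaussian_field_def
    using gaussian_fieldD[OF self_similar_gaussian_fieldD(2)[OF X]]
    by (intro allI impI centered_gaussian_rv_distr[OF T]) auto
  moreover have "self_similar H (distr M N T) Y"
    unfolding self_similar_def
    using self_similar_gaussian_fieldD(3)[OF X] unfolding self_similar_def
    by (intro allI impI same_fdd_distr[OF T]) auto
  moreover have "stationary_increments (distr M N T) Y"
    unfolding stationary_increments_def
    using self_similar_gaussian_fieldD(4)[OF X] unfolding stationary_increments_def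
    by (intro allI same_fdd_distr[OF T]) auto
  moreover have cov: "(\<integral>\<omega>. Y x \<omega> * Y y \<omega> \<partial>distr M N T) = (\<integral>\<omega>. Y x (T \<omega>) * Y y (T \<omega>) \<partial>M)" for x y
    by (intro integral_distr T) measurable
  ultimately show ?thesis
    unfolding self_similar_gaussian_field_def
    using self_similar_gaussian_fieldD(1)[OF X]
      has_spectral_density_cong[OF self_similar_gaussian_fieldD(5)[OF X] cov] by blast
qed

subsection \<open>Tangent fields\<close>

text \<open>The error in the derivative is small relative to the increment of the argument, and this
  is uniform over \<open>u\<close> because \<open>K\<close> is bounded.\<close>

lemma scaled_increment_uniform_limit:
  fixes g :: "real^2 \<Rightarrow> real^2"
  assumes g: "(g has_derivative A) (at x0)" and K: "compact K"
    and \<rho>: "\<And>n. \<rho> n > 0" "\<rho> \<longlonglongrightarrow> 0"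
  shows "uniform_limit K (\<lambda>n u. (g (x0 + \<rho> n *\<^sub>R u) - g x0) /\<^sub>R \<rho> n) A sequentially"
proof (rule uniform_limitI)
  fix e :: real assume e: "e > 0"
  have lin: "linear A"
    using has_derivative_bounded_linear[OF g] by (simp add: bounded_linear.linear)
  obtain B where B: "B > 0" "\<And>u. u \<in> K \<Longrightarrow> norm u \<le> B"
    using compact_imp_bounded[OF K] by (auto simp: bounded_pos)
  define e' where "e' = e / (2 * B)"
  have e': "e' > 0" using e B by (simp add: e'_def)
  obtain d where d: "d > 0"
    "\<And>y. norm (y - x0) < d \<Longrightarrow> norm (g y - g x0 - A (y - x0)) \<le> e' * norm (y - x0)"
    using g e' unfolding has_derivative_at_alt by blast
  have "\<forall>\<^sub>F n in sequentially. \<rho> n < d / B"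
    using order_tendstoD(2)[OF \<rho>(2), of "d / B"] d B by simp
  then show "\<forall>\<^sub>F n in sequentially. \<forall>u\<in>K. dist ((g (x0 + \<rho> n *\<^sub>R u) - g x0) /\<^sub>R \<rho> n) (A u) < e"
  proof eventually_elim
    case (elim n)
    show ?case
    proof
      fix u assume u: "u \<in> K"
      let ?y = "x0 + \<rho> n *\<^sub>R u"
      have ny: "norm (?y - x0) = \<rho> n * norm u" using \<rho>(1)[of n] by simp
      also have "\<rho> n * norm u \<le> \<rho> n * B"
        using B(2)[OF u] \<rho>(1)[of n] by (intro mult_left_mono) auto
      also have "\<rho> n * B < d"
        using elim B(1) by (simp add: field_simps)
      finally have "norm (?y - x0) < d" .
      from d(2)[OF this] have "norm (g ?y - g x0 - A (?y - x0)) \<le> e' * (\<rho> n * norm u)"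
        unfolding ny .
      then have "norm (g ?y - g x0 - A (?y - x0)) / \<rho> n \<le> e' * norm u"
        using \<rho>(1)[of n] by (simp add: pos_divide_le_eq mult_ac)
      moreover have "(g ?y - g x0) /\<^sub>R \<rho> n - A u = (g ?y - g x0 - A (?y - x0)) /\<^sub>R \<rho> n"
        using \<rho>(1)[of n] by (simp add: linear_cmul[OF lin] scaleR_diff_right)
      ultimately have "norm ((g ?y - g x0) /\<^sub>R \<rho> n - A u) \<le> e' * norm u"
        using \<rho>(1)[of n] by (simp add: divide_inverse_commute)
      also have "\<dots> \<le> e' * B"
        using B(2)[OF u] e' by (intro mult_left_mono) auto
      also have "\<dots> < e" using e B(1) by (simp add: e'_def)
      finally show "dist ((g ?y - g x0) /\<^sub>R \<rho> n) (A u) < e" by (simp add: dist_norm)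
    qed
  qed
qed

text \<open>The identity is exact for every \<open>\<rho>\<close>: stationarity for the shift
  \<open>h\<close> at the arguments \<open>g u - h\<close>, then \<open>X 0 = 0\<close> almost
  surely, then self-similarity. As these compare finite-dimensional laws, \<open>g\<close> may be
  nonlinear.\<close>

lemma rescaled_increments_same_fdd:
  assumes X: "self_similar_gaussian_field H M X C" and \<rho>: "\<rho> > 0"
  shows "same_fdd M (\<lambda>u \<omega>. \<rho> powr (-H) * (X (g u) \<omega> - X h \<omega>)) (\<lambda>u. X ((g u - h) /\<^sub>R \<rho>))"
proof -
  note [measurable] = self_similar_gaussian_fieldD(6)[OF X]
  have "same_fdd M (\<lambda>x \<omega>. X (x + h) \<omega> - X h \<omega>) (\<lambda>x \<omega>. X x \<omega> - X 0 \<omega>)"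
    using self_similar_gaussian_fieldD(4)[OF X] unfolding stationary_increments_def by blast
  from same_fdd_transform[OF _ _ this, of "\<rho> powr (-H)" "\<lambda>u. g u - h"]
  have 1: "same_fdd M (\<lambda>u \<omega>. \<rho> powr (-H) * (X (g u) \<omega> - X h \<omega>))
      (\<lambda>u \<omega>. \<rho> powr (-H) * (X (g u - h) \<omega> - X 0 \<omega>))"
    by simp
  have "AE \<omega> in M. \<rho> powr (-H) * (X (g u - h) \<omega> - X 0 \<omega>) = \<rho> powr (-H) * X (g u - h) \<omega>" for u
    using self_similar_gaussian_field_zero[OF X] by eventually_elim simp
  then have 2: "same_fdd M (\<lambda>u \<omega>. \<rho> powr (-H) * (X (g u - h) \<omega> - X 0 \<omega>))
      (\<lambda>u \<omega>. \<rho> powr (-H) * X (g u - h) \<omega>)"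
    by (intro same_fdd_AE) measurable
  have "same_fdd M (\<lambda>x. X (\<rho> *\<^sub>R x)) (\<lambda>x \<omega>. \<rho> powr H * X x \<omega>)"
    using self_similar_gaussian_fieldD(3)[OF X] \<rho> unfolding self_similar_def by blast
  from same_fdd_transform[OF _ _ this, of "\<rho> powr (-H)" "\<lambda>u. (g u - h) /\<^sub>R \<rho>"]
  have "same_fdd M (\<lambda>u \<omega>. \<rho> powr (-H) * X (\<rho> *\<^sub>R ((g u - h) /\<^sub>R \<rho>)) \<omega>)
      (\<lambda>u \<omega>. \<rho> powr (-H) * (\<rho> powr H * X ((g u - h) /\<^sub>R \<rho>) \<omega>))"
    by simp
  moreover have "\<rho> *\<^sub>R ((g u - h) /\<^sub>R \<rho>) = g u - h" for u
    using \<rho> by simp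
  moreover have "\<rho> powr (-H) * (\<rho> powr H * z) = z" for z
    using \<rho> by (simp add: mult.assoc[symmetric] powr_add[symmetric])
  ultimately have 3: "same_fdd M (\<lambda>u \<omega>. \<rho> powr (-H) * X (g u - h) \<omega>) (\<lambda>u. X ((g u - h) /\<^sub>R \<rho>))"
    by simp
  show ?thesis
    by (rule same_fdd_trans[OF 1 same_fdd_trans[OF 2 3]])
qed

text \<open>The tangent field lives on the space of continuous functions, so that it is its own
  continuous version.\<close>

lemma tangent_field_compose:
  fixes g R :: "real^2 \<Rightarrow> real^2"
  assumes X: "self_similar_gaussian_field H M X C" and H: "0 < H"
    and g: "continuous_on UNIV g" "(g has_derivative (\<lambda>u. c *\<^sub>R R u)) (at x0)"
    and c: "c > 0" and R: "orthogonal_transformation R"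
    and nontrivial: "\<exists>u. \<not> (AE \<omega> in M. X u \<omega> = 0)"
  shows "\<exists>(N :: (real^2 \<Rightarrow> real) measure) Y. has_tangent_field H M (\<lambda>x. X (g x)) x0 N Y \<and>
    self_similar_gaussian_field H N Y (\<lambda>\<Theta>. c powr (2 * H) * C (R \<Theta>))"
proof -
  interpret prob_space M by (rule self_similar_gaussian_fieldD(1)[OF X])
  let ?A = "\<lambda>u. c *\<^sub>R R u"
  obtain X' where X': "continuous_version M X X'"
    using self_similar_gaussian_field_continuous_version[OF X H] by blast
  then have X'_meas [measurable]: "X' x \<in> borel_measurable M"
    and X'_ae: "AE \<omega> in M. X' x \<omega> = X x \<omega>"
    and X'_cont: "\<omega> \<in> space M \<Longrightarrow> continuous_on UNIV (\<lambda>x. X' x \<omega>)" for x \<omega>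
    by (auto simp: continuous_version_def)
  have X'_field: "self_similar_gaussian_field H M X' C"
    by (rule self_similar_gaussian_field_version[OF X X'_meas X'_ae])
  have lin: "linear ?A"
    using g(2) has_derivative_bounded_linear bounded_linear.linear by blast
  have A_cont: "continuous_on UNIV ?A"
    by (rule linear_continuous_on[OF has_derivative_bounded_linear[OF g(2)]])
  have XA_cont: "continuous_on UNIV (\<lambda>x. X' (\<phi> x) \<omega>)"
    if "\<omega> \<in> space M" "continuous_on UNIV \<phi>" for \<omega> and \<phi> :: "real^2 \<Rightarrow> real^2"
    using continuous_on_compose2[OF X'_cont[OF that(1)] that(2)] by auto
  \<comment> \<open>Evaluations generate the sigma-algebra, so \<open>T\<close> is checked
    coordinatewise, and its law puts the tangent field on a space of functions, as
    \<open>has_local_structure_tensor\<close> requires.\<close>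
  define E :: "(real^2 \<Rightarrow> real) measure" where
    "E = restrict_space (Pi\<^sub>M UNIV (\<lambda>_. borel)) {f. continuous_on UNIV f}"
  have space_E: "space E = {f. continuous_on UNIV f}"
    by (auto simp: E_def space_restrict_space space_PiM PiE_def extensional_def)
  have eval: "(\<lambda>f. f u) \<in> borel_measurable E" for u
    unfolding E_def by (intro measurable_restrict_space1 measurable_component_singleton) simp
  define T where "T \<omega> u = X' (?A u) \<omega>" for \<omega> u
  have T: "T \<in> measurable M E"
    unfolding E_def
  proof (rule measurable_restrict_space2)
    show "T \<in> space M \<rightarrow> {f. continuous_on UNIV f}"
      using XA_cont[OF _ A_cont] by (simp add: T_def)
    have "(\<lambda>\<omega>. \<lambda>u\<in>UNIV. X' (?A u) \<omega>) \<in> measurable M (Pi\<^sub>M UNIV (\<lambda>_. borel))"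
      by (intro measurable_restrict X'_meas)
    then show "T \<in> measurable M (Pi\<^sub>M UNIV (\<lambda>_. borel))"
      by (simp add: T_def[abs_def] restrict_def)
  qed
  define N where "N = distr M E T"
  define Y where "Y u f = f u" for u :: "real^2" and f :: "real^2 \<Rightarrow> real"
  have Y_meas: "Y u \<in> borel_measurable E" for u
    using eval by (simp add: Y_def[abs_def])
  have YT: "(\<lambda>x \<omega>. Y x (T \<omega>)) = (\<lambda>x. X' (?A x))"
    by (simp add: Y_def T_def)
  have field: "self_similar_gaussian_field H N Y (\<lambda>\<Theta>. c powr (2 * H) * C (R \<Theta>))"
    unfolding N_def
    by (rule self_similar_gaussian_field_distr[OF T Y_meas])
      (unfold YT, rule self_similar_gaussian_field_rotate[OF R c X'_field])
  obtain u where u: "\<not> (AE \<omega> in M. X u \<omega> = 0)" using nontrivial by blast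
  \<comment> \<open>Pulling \<open>u\<close> back through the differential makes the tangent field
    at \<open>v\<close> equal to \<open>X' u\<close>, which is not almost surely zero.\<close>
  obtain v where v: "R v = u /\<^sub>R c"
    using orthogonal_transformation_surj[OF R] by (metis surj_def)
  have Av: "?A v = u" using c by (simp add: v)
  have "has_tangent_field H M (\<lambda>x. X (g x)) x0 N Y"
    unfolding has_tangent_field_def
  proof (intro conjI exI)
    show "prob_space M" by (rule prob_space_axioms)
    show "prob_space N" unfolding N_def by (rule prob_space_distr[OF T])
    show "continuous_version M (\<lambda>x. X (g x)) (\<lambda>x. X' (g x))"
      unfolding continuous_version_def using X'_meas X'_ae XA_cont[OF _ g(1)] by blast
    show "continuous_version N Y Y"
      using Y_meas by (simp add: continuous_version_def N_def space_E Y_def)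
    show "\<not> (AE \<omega> in N. Y v \<omega> = 0)"
    proof
      assume "AE \<omega> in N. Y v \<omega> = 0"
      then have "AE \<omega> in M. Y v (T \<omega>) = 0"
        unfolding N_def by (rule AE_distrD[OF T])
      then have "AE \<omega> in M. X' u \<omega> = 0"
        by (simp add: Y_def T_def Av)
      with X'_ae[of u] have "AE \<omega> in M. X u \<omega> = 0" by eventually_elim simp
      with u show False by blast
    qed
    show "converges_in_distribution M
        (\<lambda>\<rho> u \<omega>. \<rho> powr (-H) * (X' (g (x0 + \<rho> *\<^sub>R u)) \<omega> - X' (g x0) \<omega>)) N Y (at_right 0)"
      unfolding converges_in_distribution_def tendsto_at_iff_sequentially
    proof (intro allI impI)
      \<comment> \<open>The limit from the right is tested along sequences, for which dominated
        convergence is available.\<close>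
      fix F and \<rho> :: "nat \<Rightarrow> real"
      assume F: "bounded_continuous_functional F" and "\<forall>i. \<rho> i \<in> {0<..} - {0}" and lim: "\<rho> \<longlonglongrightarrow> 0"
      then have \<rho>: "\<rho> n > 0" for n by auto
      define \<phi> where "\<phi> n u = (g (x0 + \<rho> n *\<^sub>R u) - g x0) /\<^sub>R \<rho> n" for n u
      have g_cont: "continuous_on UNIV (\<lambda>u. g (x0 + \<rho> n *\<^sub>R u))" for n
        by (rule continuous_on_compose2[OF g(1)]) (auto intro!: continuous_intros)
      then have \<phi>_cont: "continuous_on UNIV (\<phi> n)" for n
        unfolding \<phi>_def by (intro continuous_intros)
      \<comment> \<open>Rescaled increments are traded, for each \<open>n\<close>, for one fixed
        field evaluated at moving points.\<close>
      have "(\<integral>\<omega>. F (\<lambda>u. \<rho> n powr (-H) * (X' (g (x0 + \<rho> n *\<^sub>R u)) \<omega> - X' (g x0) \<omega>)) \<partial>M) =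
          (\<integral>\<omega>. F (\<lambda>u. X' (\<phi> n u) \<omega>) \<partial>M)" for n
        unfolding \<phi>_def
        by (rule same_fdd_functional_integral[OF _ F _ _ _ _
              rescaled_increments_same_fdd[OF X'_field \<rho>]])
          (auto intro!: continuous_intros XA_cont[OF _ g_cont] XA_cont[OF _ \<phi>_cont[unfolded \<phi>_def]]
            finite_measure_axioms)
      moreover have "(\<lambda>n. \<integral>\<omega>. F (\<lambda>u. X' (\<phi> n u) \<omega>) \<partial>M) \<longlonglongrightarrow> (\<integral>\<omega>. F (\<lambda>u. X' (?A u) \<omega>) \<partial>M)"
        by (rule functional_integral_uniform_limit[OF finite_measure_axioms F X'_meas X'_cont \<phi>_cont A_cont])
          (auto simp: \<phi>_def[abs_def] intro!: scaled_increment_uniform_limit[OF g(2)] \<rho> lim)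
      moreover have "(\<integral>f. F (\<lambda>u. Y u f) \<partial>N) = (\<integral>\<omega>. F (\<lambda>u. X' (?A u) \<omega>) \<partial>M)"
      proof -
        have "(\<lambda>f. F (\<lambda>u. Y u f)) \<in> borel_measurable E"
          by (rule functional_measurable[OF F Y_meas]) (simp add: space_E Y_def)
        then show ?thesis
          unfolding N_def by (subst integral_distr[OF T]) (simp_all add: Y_def T_def)
      qed
      ultimately show "((\<lambda>\<rho>. \<integral>\<omega>. F (\<lambda>u. \<rho> powr (-H) *
            (X' (g (x0 + \<rho> *\<^sub>R u)) \<omega> - X' (g x0) \<omega>)) \<partial>M) \<circ> \<rho>) \<longlonglongrightarrow> (\<integral>f. F (\<lambda>u. Y u f) \<partial>N)"
        by (simp add: o_def)
    qed
  qed
  with field show ?thesis by blast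
qed

subsection \<open>Rotations and the elementary anisotropy function\<close>

lemma interval_integral_translate:
  fixes f :: "real \<Rightarrow> real" and a b h :: real
  shows "(LBINT x=ereal a..ereal b. f (x + h)) = (LBINT x=ereal (a + h)..ereal (b + h). f x)"
proof (induct a b rule: linorder_wlog)
  case (le a b)
  have "indicator {a + h..b + h} (h + x) = (indicator {a..b} x :: real)" for x
    by (simp add: indicator_def)
  then show ?case
    using le by (simp add: interval_integral_Icc set_lebesgue_integral_def
      lborel_integral_real_affine[of 1 "\<lambda>x. indicator {a + h..b + h} x * f x" h] add.commute)
next
  case (sym a b)
  then show ?case
    using interval_integral_endpoints_reverse[of "ereal a" "ereal b"]
      interval_integral_endpoints_reverse[of "ereal (a + h)" "ereal (b + h)"] by metis
qed

lemma interval_integrable_bounded: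
  fixes f :: "real \<Rightarrow> real" and a b :: real
  assumes "f \<in> borel_measurable borel" "\<And>x. \<bar>f x\<bar> \<le> B"
  shows "interval_lebesgue_integrable lborel (ereal a) (ereal b) f"
proof -
  have "integrable lborel (\<lambda>x. indicator {p<..<q} x *\<^sub>R f x)" for p q
    by (rule integrableI_bounded_set_indicator[where B = B]) (use assms in \<open>auto simp: emeasure_bounded_finite[unfolded infinity_ennreal_def]\<close>)
  then show ?thesis
    by (simp add: interval_lebesgue_integrable_def set_integrable_def)
qed

text \<open>The two windows differ by the integral from \<open>b\<close> to \<open>a\<close> and its
  translate by \<open>L\<close>, which cancel; oriented integrals treat both orders of
  \<open>a\<close> and \<open>b\<close> together.\<close>

lemma interval_integral_periodic:
  fixes f :: "real \<Rightarrow> real" and a b L :: real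
  assumes f: "f \<in> borel_measurable borel" "\<And>x. \<bar>f x\<bar> \<le> B" and per: "\<And>x. f (x + L) = f x"
  shows "(LBINT x=ereal a..ereal (a + L). f x) = (LBINT x=ereal b..ereal (b + L). f x)"
proof -
  have sum: "(LBINT x=ereal p..ereal q. f x) + (LBINT x=ereal q..ereal r. f x) = (LBINT x=ereal p..ereal r. f x)"
    for p q r
  proof (rule interval_integral_sum)
    show "interval_lebesgue_integrable lborel (min (ereal p) (min (ereal q) (ereal r)))
        (max (ereal p) (max (ereal q) (ereal r))) f"
      using interval_integrable_bounded[OF f, of "min p (min q r)" "max p (max q r)"]
      by (simp add: ereal_min ereal_max)
  qed
  have "(LBINT x=ereal b..ereal a. f x) = (LBINT x=ereal (b + L)..ereal (a + L). f x)"
    using interval_integral_translate[of b a f L] by (simp add: per)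
  then show ?thesis
    using sum[of a b "a + L"] sum[of b "b + L" "a + L"] sum[of b a b] sum[of b b b] by simp
qed

lemma vec_of_complex_of_vec [simp]: "vec_of_complex (complex_of_vec x) = x"
  by (simp add: complex_of_vec_def vec_of_complex_def vec_eq_iff forall_2)

lemma inner_vec_of_complex: "vec_of_complex z \<bullet> vec_of_complex w = z \<bullet> w"
  by (simp add: vec_of_complex_def inner_vec_def sum_2 inner_complex_def)

lemma bounded_linear_vec_of_complex: "bounded_linear vec_of_complex"
  by (intro linear_conv_bounded_linear[THEN iffD1] linearI)
    (simp_all add: vec_of_complex_def vec_eq_iff forall_2)

lemma bounded_linear_complex_of_vec: "bounded_linear complex_of_vec"
  by (intro linear_conv_bounded_linear[THEN iffD1] linearI)
    (simp_all add: complex_of_vec_def complex_eq_iff)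

text \<open>Going through complex multiplication matches the derivative of a holomorphic
  map.\<close>

definition rotation :: "real \<Rightarrow> real^2 \<Rightarrow> real^2" where
  "rotation t x = vec_of_complex (cis t * complex_of_vec x)"

lemma orthogonal_transformation_rotation: "orthogonal_transformation (rotation t)"
proof -
  have "linear (rotation t)"
    unfolding rotation_def
    by (intro bounded_linear.linear bounded_linear_compose[OF bounded_linear_vec_of_complex]
        bounded_linear_const_mult bounded_linear_complex_of_vec)
  moreover have "norm (rotation t x) = norm x" for x
  proof -
    have "norm (vec_of_complex z) = norm z" for z
      by (simp add: norm_eq_sqrt_inner inner_vec_of_complex)
    moreover from this[of "complex_of_vec x"] have "norm (complex_of_vec x) = norm x" by simp
    ultimately show ?thesis by (simp add: rotation_def norm_mult)
  qed
  ultimately show ?thesis by (simp add: orthogonal_transformation)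
qed

lemma complex_of_circle_point: "complex_of_vec (circle_point \<theta>) = cis \<theta>"
  by (simp add: complex_of_vec_def circle_point_def cis.code)

lemma rotation_circle_point: "rotation t (circle_point \<theta>) = circle_point (\<theta> + t)"
proof -
  have "rotation t (circle_point \<theta>) = vec_of_complex (cis (\<theta> + t))"
    by (simp add: rotation_def complex_of_circle_point cis_mult add.commute)
  then show ?thesis by (simp add: vec_of_complex_def circle_point_def)
qed

text \<open>Were the variance at this point zero, the nonnegative spectral integrand would vanish
  almost everywhere, yet it is positive on a nonempty open box. Tangent fields are required to be
  nontrivial.\<close>

lemma elementary_field_nontrivial:
  assumes X: "self_similar_gaussian_field H M X (elementary_anisotropy \<delta>)" and \<delta>: "\<delta> > 0"
  shows "\<not> (AE \<omega> in M. X (axis 1 1) \<omega> = 0)"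
proof
  let ?e = "axis 1 1 :: real^2"
  define f where "f \<xi> = norm \<xi> powr (-2 * H - 2) * elementary_anisotropy \<delta> (\<xi> /\<^sub>R norm \<xi>)" for \<xi>
  assume ae: "AE \<omega> in M. X ?e \<omega> = 0"
  have "has_spectral_density M X f"
    using self_similar_gaussian_fieldD(5)[OF X] by (simp add: f_def[abs_def])
  then have f [measurable]: "f \<in> borel_measurable borel" and f0: "\<And>\<xi>. f \<xi> \<ge> 0"
    and int: "integrable lborel (\<lambda>\<xi>. spectral_kernel ?e ?e \<xi> * of_real (f \<xi>))"
    and cov: "of_real (\<integral>\<omega>. X ?e \<omega> * X ?e \<omega> \<partial>M) =
       (\<integral>\<xi>. spectral_kernel ?e ?e \<xi> * of_real (f \<xi>) \<partial>lborel)"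
    unfolding has_spectral_density_def by blast+
  \<comment> \<open>On the diagonal the kernel is the squared modulus of
    \<open>cis (\<xi> $ 1) - 1\<close>.\<close>
  have k: "spectral_kernel ?e ?e \<xi> * of_real (f \<xi>) = complex_of_real ((2 - 2 * cos (\<xi> $ 1)) * f \<xi>)" for \<xi>
  proof -
    have "spectral_kernel ?e ?e \<xi> = (cis (\<xi> $ 1) - 1) * (cis (- (\<xi> $ 1)) - 1)"
      by (simp add: spectral_kernel_def cis_conv_exp inner_axis')
    also have "\<dots> = 2 - (cis (\<xi> $ 1) + cis (- (\<xi> $ 1)))"
      by (simp add: algebra_simps cis_mult)
    also have "\<dots> = of_real (2 - 2 * cos (\<xi> $ 1))"
      by (simp add: complex_eq_iff)
    finally show ?thesis by simp
  qed
  have "(\<integral>\<omega>. X ?e \<omega> * X ?e \<omega> \<partial>M) = 0"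
    using ae by (intro integral_eq_zero_AE) auto
  then have zero: "(\<integral>\<xi>. (2 - 2 * cos (\<xi> $ 1)) * f \<xi> \<partial>lborel) = 0"
    using cov unfolding k by (simp del: of_real_mult)
  have int': "integrable lborel (\<lambda>\<xi>. (2 - 2 * cos (\<xi> $ 1)) * f \<xi>)"
    using int unfolding k by (simp only: complex_of_real_integrable_eq)
  have nonneg: "0 \<le> (2 - 2 * cos (\<xi> $ 1)) * f \<xi>" for \<xi>
    using f0[of \<xi>] cos_le_one[of "\<xi> $ 1"] by (intro mult_nonneg_nonneg) auto
  have null: "AE \<xi> in lborel. (2 - 2 * cos (\<xi> $ 1)) * f \<xi> = 0"
    using zero integral_nonneg_eq_0_iff_AE[OF int'] nonneg by simp
  \<comment> \<open>First coordinates between \<open>1\<close> and \<open>2\<close> keep the cosine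
    below \<open>1\<close> and make the angle at most the absolute second coordinate, hence less
    than \<open>\<delta>\<close>.\<close>
  define U :: "(real^2) set" where "U = box (vector [1, -\<delta>]) (vector [2, \<delta>])"
  have "(2 - 2 * cos (\<xi> $ 1)) * f \<xi> \<noteq> 0" if "\<xi> \<in> U" for \<xi>
  proof -
    have \<xi>: "1 < \<xi> $ 1" "\<xi> $ 1 < 2" "\<bar>\<xi> $ 2\<bar> < \<delta>"
      using that by (auto simp: U_def mem_box_cart forall_2)
    have "cos (\<xi> $ 1) < cos 0"
      using \<xi> pi_gt3 by (intro cos_monotone_0_pi) auto
    moreover have "f \<xi> > 0"
    proof -
      have \<xi>0: "norm \<xi> > 0" using \<xi>(1) by auto
      have "complex_of_vec (\<xi> /\<^sub>R norm \<xi>) = of_real (inverse (norm \<xi>)) * complex_of_vec \<xi>"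
        unfolding linear_cmul[OF bounded_linear.linear[OF bounded_linear_complex_of_vec]]
        by (rule scaleR_conv_of_real)
      then have "Arg (complex_of_vec (\<xi> /\<^sub>R norm \<xi>)) = Arg (complex_of_vec \<xi>)"
        using \<xi>0 by (simp del: of_real_inverse)
      also have "\<dots> = arctan (\<xi> $ 2 / \<xi> $ 1)"
        using \<xi>(1) by (simp add: arg_conv_arctan complex_of_vec_def)
      finally have "\<bar>Arg (complex_of_vec (\<xi> /\<^sub>R norm \<xi>))\<bar> \<le> \<bar>\<xi> $ 2 / \<xi> $ 1\<bar>"
        by (simp only: abs_arctan_le)
      also have "\<dots> \<le> \<bar>\<xi> $ 2\<bar> / 1"
        unfolding abs_divide using \<xi>(1) by (intro divide_left_mono) auto
      also have "\<dots> < \<delta>" using \<xi>(3) by simp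
      finally have "Arg (complex_of_vec (\<xi> /\<^sub>R norm \<xi>)) + 2 * pi * of_int 0 \<in> {-\<delta>..\<delta>}"
        by auto
      then have "arg_in {-\<delta>..\<delta>} (\<xi> /\<^sub>R norm \<xi>)"
        unfolding arg_in_def by blast
      then have "elementary_anisotropy \<delta> (\<xi> /\<^sub>R norm \<xi>) > 0"
        using \<delta> unfolding elementary_anisotropy_def by (intro mult_pos_pos) auto
      then show ?thesis using \<xi>0 by (simp add: f_def)
    qed
    ultimately show ?thesis by simp
  qed
  with null have "AE \<xi> in lborel. \<xi> \<notin> U"
    by (auto elim: eventually_mono)
  then have "U \<in> null_sets lborel"
    by (subst (asm) AE_iff_null_sets[symmetric]) (auto simp: U_def)
  then have "negligible U"
    by (simp add: negligible_iff_null_sets null_sets_completionI)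
  moreover have "open U" "U \<noteq> {}"
    using \<delta> by (auto simp: U_def interval_ne_empty_cart forall_2)
  ultimately show False using open_not_negligible by blast
qed

section \<open>The elementary anisotropy function in the angular variable\<close>

lemma arg_in_circle_point: "arg_in I (circle_point \<theta>) \<longleftrightarrow> (\<exists>k::int. \<theta> + 2 * pi * of_int k \<in> I)"
proof -
  have "cis (Arg (cis \<theta>)) = cis \<theta>" by (simp add: cis_Arg)
  then have "sin (Arg (cis \<theta>)) = sin \<theta> \<and> cos (Arg (cis \<theta>)) = cos \<theta>"
    by (simp add: complex_eq_iff)
  then obtain n :: int where n: "Arg (cis \<theta>) = \<theta> + 2 * pi * of_int n"
    unfolding sin_cos_eq_iff by blast
  have "arg_in I (circle_point \<theta>) \<longleftrightarrow> (\<exists>k::int. \<theta> + 2 * pi * of_int (n + k) \<in> I)"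
    unfolding arg_in_def complex_of_circle_point n by (simp add: algebra_simps)
  also have "\<dots> \<longleftrightarrow> (\<exists>k::int. \<theta> + 2 * pi * of_int k \<in> I)"
    by (metis add_diff_cancel_left' add_diff_eq)
  finally show ?thesis .
qed

text \<open>Two representatives of an angle differ by a multiple of \<open>2 * pi\<close>, so at
  most one lies in this window. Starting at \<open>- (pi / 2)\<close> keeps the arcs around
  \<open>0\<close> and \<open>pi\<close> unbroken.\<close>

lemma arg_in_interval:
  assumes s: "- (pi / 2) \<le> s" "s < 3 * pi / 2" and I: "I \<subseteq> {- (pi / 2)<..<3 * pi / 2}"
  shows "arg_in I (circle_point s) \<longleftrightarrow> s \<in> I"
proof
  assume "arg_in I (circle_point s)"
  then obtain k :: int where k: "s + 2 * pi * of_int k \<in> I"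
    unfolding arg_in_circle_point by blast
  then have "- (pi / 2) < s + 2 * pi * of_int k" "s + 2 * pi * of_int k < 3 * pi / 2"
    using I by auto
  then have "2 * pi * of_int k < 2 * pi * 1" "2 * pi * (-1) < 2 * pi * of_int k"
    using s by linarith+
  then have "of_int k < (1::real)" "(-1::real) < of_int k"
    using pi_gt_zero by (simp_all only: mult_less_cancel_left_pos mult_pos_pos zero_less_numeral)
  then have "k = 0" by linarith
  with k show "s \<in> I" by simp
next
  assume "s \<in> I"
  then have "s + 2 * pi * of_int 0 \<in> I" by simp
  then show "arg_in I (circle_point s)" unfolding arg_in_circle_point by blast
qed

lemma elementary_anisotropy_measurable:
  "(\<lambda>s. elementary_anisotropy \<delta> (circle_point s)) \<in> borel_measurable borel"
proof -
  have "Measurable.pred borel (\<lambda>s::real. arg_in {a..b} (circle_point s))" for a b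
    unfolding arg_in_circle_point atLeastAtMost_iff by measurable
  then show ?thesis
    unfolding elementary_anisotropy_def by measurable
qed

lemma elementary_anisotropy_circle_point:
  assumes "0 < \<delta>" "\<delta> < 1" "- (pi / 2) \<le> s" "s < 3 * pi / 2"
  shows "elementary_anisotropy \<delta> (circle_point s) =
    1 / (4 * \<delta>) * (indicator {-\<delta>..\<delta>} s + indicator {pi - \<delta>..pi + \<delta>} s)"
proof -
  have "arg_in {-\<delta>..\<delta>} (circle_point s) \<longleftrightarrow> s \<in> {-\<delta>..\<delta>}"
    "arg_in {pi - \<delta>..pi + \<delta>} (circle_point s) \<longleftrightarrow> s \<in> {pi - \<delta>..pi + \<delta>}"
    using assms pi_gt3 by (intro arg_in_interval; auto)+
  then show ?thesis by (simp add: elementary_anisotropy_def indicator_def)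
qed

subsection \<open>The local structure tensor\<close>

text \<open>Shifting the angle by \<open>\<alpha>\<close> centres the arcs at \<open>0\<close> and
  \<open>pi\<close>. There the tensor is a mean over \<open>{-\<delta>..\<delta>}\<close> of a
  quadratic form in \<open>cos s\<close> and \<open>sin s\<close>: the mixed term is odd, and the
  remaining deviation is of size \<open>(sin s)\<^sup>2\<close>.\<close>

lemma structure_tensor_elementary_rotated:
  fixes \<alpha> \<delta> c :: real
  assumes \<delta>: "0 < \<delta>" "\<delta> < 1"
  defines "m \<equiv> circle_point \<alpha>"
  shows "\<bar>structure_tensor (\<lambda>\<Theta>. c * elementary_anisotropy \<delta> (rotation (-\<alpha>) \<Theta>)) $ k $ l - c * (m $ k * m $ l)\<bar>
    \<le> 2 * \<bar>c\<bar> * \<delta>\<^sup>2"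
proof -
  define w where "w s = elementary_anisotropy \<delta> (circle_point s)" for s
  define q where "q s = circle_point (s + \<alpha>) $ k * circle_point (s + \<alpha>) $ l" for s
  define P where "P s = q s * (c * w s)" for s
  have per: "circle_point (s + 2 * pi) = circle_point s" "circle_point (s + pi) = - circle_point s" for s
    by (simp_all add: circle_point_def vec_eq_iff forall_2)
  have abs1: "\<bar>circle_point s $ i\<bar> \<le> 1" for s i
    using exhaust_2[of i] by (auto simp: circle_point_def)
  have cp_meas [measurable]: "(\<lambda>s. circle_point s $ i) \<in> borel_measurable borel" for i
    using exhaust_2[of i] by (auto simp: circle_point_def)
  have w_meas [measurable]: "w \<in> borel_measurable borel"
    unfolding w_def by (rule elementary_anisotropy_measurable)
  have q_meas [measurable]: "q \<in> borel_measurable borel"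
    unfolding q_def by measurable
  have q1: "\<bar>q s\<bar> \<le> 1" for s
    unfolding q_def abs_mult using mult_mono[OF abs1 abs1] by simp
  have P_meas: "P \<in> borel_measurable borel"
    unfolding P_def by measurable
  have w_bound: "0 \<le> w s" "w s \<le> 1 / (2 * \<delta>)" for s
    using \<delta> unfolding w_def elementary_anisotropy_def by (auto simp: of_bool_def field_simps)
  have P_bound: "\<bar>P s\<bar> \<le> 1 * (\<bar>c\<bar> * (1 / (2 * \<delta>)))" for s
    unfolding P_def abs_mult using w_bound[of s] by (intro mult_mono q1) auto
  have P_per: "P (s + 2 * pi) = P s" for s
    by (simp only: P_def q_def w_def per(1) add.assoc[of s "2 * pi"] add.commute[of "2 * pi" \<alpha>]
        add.assoc[symmetric])
  have "structure_tensor (\<lambda>\<Theta>. c * elementary_anisotropy \<delta> (rotation (-\<alpha>) \<Theta>)) $ k $ l =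
      (LINT \<theta>:{0..2 * pi}|lborel. P (\<theta> + (- \<alpha>)))"
    by (simp add: structure_tensor_def rotation_circle_point P_def q_def w_def)
  also have "\<dots> = (LBINT \<theta>=ereal 0..ereal (2 * pi). P (\<theta> + (- \<alpha>)))"
    by (subst interval_integral_Icc) auto
  also have "\<dots> = (LBINT s=ereal (- \<alpha>)..ereal (- \<alpha> + 2 * pi). P s)"
    using interval_integral_translate[of 0 "2 * pi" P "- \<alpha>"] by (simp add: add.commute)
  \<comment> \<open>Periodicity moves the integral to the window on which the anisotropy function is
    a sum of two indicators.\<close>
  also have "\<dots> = (LBINT s=ereal (- (pi / 2))..ereal (- (pi / 2) + 2 * pi). P s)"
    by (rule interval_integral_periodic[OF P_meas P_bound P_per])
  also have "\<dots> = (LBINT s:{- (pi / 2)..<3 * pi / 2}. P s)"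
    by (subst interval_integral_Ico) auto
  also have "\<dots> = (\<integral>s. c / (4 * \<delta>) * (indicator {-\<delta>..\<delta>} s * q s + indicator {pi - \<delta>..pi + \<delta>} s * q s) \<partial>lborel)"
    unfolding set_lebesgue_integral_def
  proof (intro Bochner_Integration.integral_cong refl)
    fix s
    show "indicator {- (pi / 2)..<3 * pi / 2} s *\<^sub>R P s =
        c / (4 * \<delta>) * (indicator {-\<delta>..\<delta>} s * q s + indicator {pi - \<delta>..pi + \<delta>} s * q s)"
    proof (cases "s \<in> {- (pi / 2)..<3 * pi / 2}")
      case True
      then show ?thesis
        using elementary_anisotropy_circle_point[OF \<delta>, of s] by (simp add: P_def w_def algebra_simps)
    next
      case False
      then have "s \<notin> {-\<delta>..\<delta>}" "s \<notin> {pi - \<delta>..pi + \<delta>}"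
        using \<delta> pi_gt3 by auto
      with False show ?thesis by simp
    qed
  qed
  also have "\<dots> = c / (4 * \<delta>) * ((LINT s:{-\<delta>..\<delta>}|lborel. q s) + (LINT s:{pi - \<delta>..pi + \<delta>}|lborel. q s))"
  proof -
    have "integrable lborel (\<lambda>s. indicator {a..b} s * q s)" for a b
      using integrableI_bounded_set_indicator[of "{a..b}" lborel q 1] q1
      by (simp add: emeasure_bounded_finite[unfolded infinity_ennreal_def])
    then show ?thesis
      by (simp add: set_lebesgue_integral_def)
  qed
  \<comment> \<open>The integrand \<open>q\<close> is quadratic in the circle point, so antipodal
    arcs contribute equally.\<close>
  also have "(LINT s:{pi - \<delta>..pi + \<delta>}|lborel. q s) = (LINT s:{-\<delta>..\<delta>}|lborel. q s)"
  proof -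
    have "q (s + pi) = q s" for s
      using per(2)[of "s + \<alpha>"] by (simp add: q_def add.assoc add.commute[of pi])
    then show ?thesis
      using interval_integral_translate[of "-\<delta>" \<delta> q pi] \<delta>
      by (simp add: interval_integral_Icc[symmetric] add.commute)
  qed
  finally have J: "structure_tensor (\<lambda>\<Theta>. c * elementary_anisotropy \<delta> (rotation (-\<alpha>) \<Theta>)) $ k $ l =
      c / (2 * \<delta>) * (LINT s:{-\<delta>..\<delta>}|lborel. q s)"
    by simp
  \<comment> \<open>The unit vector orthogonal to \<open>m\<close>; the circle point at
    \<open>s + \<alpha>\<close> is \<open>cos s\<close> times \<open>m\<close> plus
    \<open>sin s\<close> times \<open>n\<close>.\<close>
  define n where "n = (vector [- sin \<alpha>, cos \<alpha>] :: real^2)"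
  define A where "A = m $ k * m $ l"
  define B where "B = n $ k * n $ l - m $ k * m $ l"
  define D where "D = m $ k * n $ l + n $ k * m $ l"
  have "circle_point (s + \<alpha>) $ i = cos s * m $ i + sin s * n $ i" for s i
    using exhaust_2[of i] by (auto simp: circle_point_def m_def n_def cos_add sin_add)
  then have q_eq: "q s = A + (D * (sin s * cos s) + B * (sin s)\<^sup>2)" for s
  proof -
    have "q s = A * (cos s)\<^sup>2 + D * (sin s * cos s) + (n $ k * n $ l) * (sin s)\<^sup>2"
      unfolding q_def \<open>\<And>s i. circle_point (s + \<alpha>) $ i = _\<close> A_def D_def
      by (simp add: power2_eq_square algebra_simps)
    also have "(cos s)\<^sup>2 = 1 - (sin s)\<^sup>2" by (rule cos_squared_eq)
    finally show ?thesis by (simp add: A_def B_def algebra_simps)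
  qed
  have int: "set_integrable lborel {-\<delta>..\<delta>} f" if "continuous_on UNIV f" for f :: "real \<Rightarrow> real"
    using that by (intro borel_integrable_atLeastAtMost') (auto intro: continuous_on_subset)
  have odd: "(LINT s:{-\<delta>..\<delta>}|lborel. sin s * cos s) = 0"
  proof -
    have "(LBINT s=ereal (-\<delta>)..ereal \<delta>. sin s * cos s) = (sin \<delta>)\<^sup>2 / 2 - (sin (-\<delta>))\<^sup>2 / 2"
      by (rule interval_integral_FTC_finite)
        (auto intro!: continuous_intros derivative_eq_intros
          simp: has_real_derivative_iff_has_vector_derivative[symmetric])
    then show ?thesis
      using \<delta> by (simp add: interval_integral_Icc)
  qed
  define S where "S = (LINT s:{-\<delta>..\<delta>}|lborel. (sin s)\<^sup>2)"
  have S: "0 \<le> S" "S \<le> 2 * \<delta> * \<delta>\<^sup>2"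
  proof -
    show "0 \<le> S"
      unfolding S_def set_lebesgue_integral_def by (intro Bochner_Integration.integral_nonneg) auto
    have "S \<le> (LINT s:{-\<delta>..\<delta>}|lborel. \<delta>\<^sup>2)"
      unfolding S_def
    proof (intro set_integral_mono int continuous_intros)
      fix s assume "s \<in> {-\<delta>..\<delta>}"
      then have "\<bar>sin s\<bar> \<le> \<delta>"
        using abs_sin_x_le_abs_x[of s] by auto
      then show "(sin s)\<^sup>2 \<le> \<delta>\<^sup>2"
        using abs_le_square_iff[of "sin s" \<delta>] \<delta> by simp
    qed
    also have "\<dots> = 2 * \<delta> * \<delta>\<^sup>2"
      using \<delta> by (simp add: set_lebesgue_integral_def)
    finally show "S \<le> 2 * \<delta> * \<delta>\<^sup>2" .
  qed
  have "(LINT s:{-\<delta>..\<delta>}|lborel. q s) = 2 * \<delta> * A + B * S"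
  proof -
    have abc: "set_integrable lborel {-\<delta>..\<delta>} (\<lambda>s. A)"
      "set_integrable lborel {-\<delta>..\<delta>} (\<lambda>s. D * (sin s * cos s))"
      "set_integrable lborel {-\<delta>..\<delta>} (\<lambda>s. B * (sin s)\<^sup>2)"
      by (intro int continuous_intros)+
    have "(LINT s:{-\<delta>..\<delta>}|lborel. q s) = (LINT s:{-\<delta>..\<delta>}|lborel. A) +
        ((LINT s:{-\<delta>..\<delta>}|lborel. D * (sin s * cos s)) + (LINT s:{-\<delta>..\<delta>}|lborel. B * (sin s)\<^sup>2))"
      unfolding q_eq by (simp only: set_integral_add(2) abc set_integral_add(1))
    also have "\<dots> = 2 * \<delta> * A + B * S"
      using \<delta> odd by (simp add: S_def set_lebesgue_integral_def)
    finally show ?thesis .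
  qed
  then have "structure_tensor (\<lambda>\<Theta>. c * elementary_anisotropy \<delta> (rotation (-\<alpha>) \<Theta>)) $ k $ l - c * A =
      c * B * (S / (2 * \<delta>))"
    unfolding J using \<delta> by (simp add: field_simps)
  also have "\<bar>\<dots>\<bar> \<le> (\<bar>c\<bar> * 2) * \<delta>\<^sup>2"
    unfolding abs_mult
  proof (intro mult_mono)
    have n1: "\<bar>n $ i\<bar> \<le> 1" for i
      using exhaust_2[of i] by (auto simp: n_def)
    have "\<bar>n $ k * n $ l\<bar> \<le> 1 * 1" "\<bar>m $ k * m $ l\<bar> \<le> 1 * 1"
      unfolding abs_mult m_def by (intro mult_mono n1 abs1; simp)+
    then show "\<bar>B\<bar> \<le> 2" unfolding B_def by linarith
    show "\<bar>S / (2 * \<delta>)\<bar> \<le> \<delta>\<^sup>2"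
      using S \<delta> by (simp add: field_simps)
  qed auto
  finally show ?thesis by (simp add: A_def mult_ac)
qed

section \<open>Orientation of the field deformed by a conformal map\<close>

theorem proposition12:
  fixes \<alpha> lam :: "real^2 \<Rightarrow> real"
    and \<Psi> \<Phi> :: "complex \<Rightarrow> complex"
    and H :: real
    and M :: "real \<Rightarrow> 'w measure"
    and X :: "real \<Rightarrow> real^2 \<Rightarrow> 'w \<Rightarrow> real"
    and x0 :: "real^2"
  assumes "harmonic \<alpha>" and "harmonic lam"
    and "\<And>x. \<Psi> (complex_of_vec x) = Complex (lam x) (- \<alpha> x)"
    and "\<Psi> holomorphic_on UNIV"
    and "\<And>z. (\<Phi> has_field_derivative exp (\<Psi> z)) (at z)"
    and "0 < H" and "H < 1"
    and "\<And>\<delta>. 0 < \<delta> \<Longrightarrow> standard_elementary_field H \<delta> (M \<delta>) (X \<delta>)"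
  shows "approx_local_orientation H M
           (\<lambda>\<delta> x. X \<delta> (vec_of_complex (\<Phi> (complex_of_vec x)))) x0
           (vector [cos (\<alpha> x0), sin (\<alpha> x0)])"
proof -
  define c where "c = exp (lam x0)"
  \<comment> \<open>The sign comes from the imaginary part \<open>- \<alpha>\<close> of
    \<open>\<Psi>\<close>. Turning the argument of the anisotropy function by \<open>t\<close> turns
    its arcs by \<open>\<alpha> x0\<close>.\<close>
  define t where "t = - \<alpha> x0"
  define g where "g x = vec_of_complex (\<Phi> (complex_of_vec x))" for x
  define C where "C \<delta> \<Theta> = c powr (2 * H) * elementary_anisotropy \<delta> (rotation t \<Theta>)" for \<delta> \<Theta>
  define m where "m = circle_point (\<alpha> x0)"
  have c: "c > 0" by (simp add: c_def)
  have g_deriv: "(g has_derivative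
      (\<lambda>u. vec_of_complex (exp (\<Psi> (complex_of_vec x)) * complex_of_vec u))) (at x)" for x
  proof -
    have "(\<Phi> has_derivative (*) (exp (\<Psi> (complex_of_vec x)))) (at (complex_of_vec x))"
      using assms(5) by (simp add: has_field_derivative_def)
    from has_derivative_compose[OF bounded_linear_imp_has_derivative[OF bounded_linear_complex_of_vec] this]
    have "((\<lambda>x. \<Phi> (complex_of_vec x)) has_derivative
        (\<lambda>u. exp (\<Psi> (complex_of_vec x)) * complex_of_vec u)) (at x)" .
    then show ?thesis
      unfolding g_def[abs_def] by (rule bounded_linear.has_derivative[OF bounded_linear_vec_of_complex])
  qed
  have g_cont: "continuous_on UNIV g"
    using has_derivative_continuous[OF g_deriv] by (simp add: continuous_on_eq_continuous_at)
  \<comment> \<open>Polar form of the derivative: dilation by \<open>c\<close> and rotation by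
    \<open>t\<close>, so the differential of \<open>g\<close> is a similarity.\<close>
  have "exp (\<Psi> (complex_of_vec x0)) = of_real c * cis t"
    by (simp add: assms(3) exp_eq_polar c_def t_def)
  then have "exp (\<Psi> (complex_of_vec x0)) * complex_of_vec u = c *\<^sub>R (cis t * complex_of_vec u)" for u
    by (simp add: scaleR_conv_of_real mult.assoc)
  then have "vec_of_complex (exp (\<Psi> (complex_of_vec x0)) * complex_of_vec u) = c *\<^sub>R rotation t u" for u
    by (simp add: rotation_def linear_cmul[OF bounded_linear.linear[OF bounded_linear_vec_of_complex]])
  with g_deriv[of x0] have g_deriv0: "(g has_derivative (\<lambda>u. c *\<^sub>R rotation t u)) (at x0)"
    by simp
  have "has_local_structure_tensor H (M \<delta>) (\<lambda>x. X \<delta> (g x)) x0 (structure_tensor (C \<delta>))" if "\<delta> > 0" for \<delta>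
  proof -
    have X: "self_similar_gaussian_field H (M \<delta>) (X \<delta>) (elementary_anisotropy \<delta>)"
      using assms(8)[OF that] by (simp add: standard_elementary_field_def)
    have "\<exists>u. \<not> (AE \<omega> in M \<delta>. X \<delta> u \<omega> = 0)"
      using elementary_field_nontrivial[OF X that] by blast
    from tangent_field_compose[OF X assms(6) g_cont g_deriv0 c orthogonal_transformation_rotation this]
    show ?thesis
      unfolding has_local_structure_tensor_def C_def[abs_def] by blast
  qed
  moreover have "(\<lambda>\<delta>. structure_tensor (C \<delta>) $ k $ l - c powr (2 * H) * (m $ k * m $ l)) \<in> O[at_right 0](\<lambda>\<delta>. \<delta>\<^sup>2)" for k l
  proof (rule bigoI)
    \<comment> \<open>The estimate is available for \<open>\<delta>\<close> between \<open>0\<close>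
      and \<open>1\<close>, which is enough near \<open>0\<close>.\<close>
    show "\<forall>\<^sub>F \<delta> in at_right 0. norm (structure_tensor (C \<delta>) $ k $ l - c powr (2 * H) * (m $ k * m $ l))
        \<le> (2 * \<bar>c powr (2 * H)\<bar>) * norm (\<delta>\<^sup>2)"
      using eventually_at_right_less[of 0] eventually_at_right_real[OF zero_less_one]
    proof eventually_elim
      case (elim \<delta>)
      then show ?case
        using structure_tensor_elementary_rotated[of \<delta> "c powr (2 * H)" "\<alpha> x0" k l]
        by (simp add: C_def[abs_def] t_def m_def)
    qed
  qed
  moreover have "norm m = 1"
    by (simp add: m_def circle_point_def norm_eq_sqrt_inner inner_vec_def sum_2 power2_eq_square[symmetric])
  \<comment> \<open>This is the constant in the rank one limit; it depends on \<open>x0\<close> and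
    \<open>H\<close> but not on \<open>\<delta>\<close>.\<close>
  moreover have "c powr (2 * H) > 0" using c by simp
  moreover have "vector [cos (\<alpha> x0), sin (\<alpha> x0)] = m"
    by (simp add: m_def circle_point_def)
  ultimately show ?thesis
    unfolding approx_local_orientation_def g_def[symmetric]
    by (auto intro!: exI[of _ "c powr (2 * H)"] exI[of _ "\<lambda>\<delta>. structure_tensor (C \<delta>)"])
qed

end
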